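(* If $Q$ is an acyclic quiver and $\mathbf{d}\in\mathbb{Z}_{\geq 0}^{Q_0}$, then $[Q,\mathbf{d}]=[Q^{\operatorname{op}},\mathbf{d}]$, where $Q^{\operatorname{op}}$ is the opposite quiver, with the same vertices as $Q$ and all arrows reversed.
   Context: Let $\mathbb{k}=\mathbb{F}_q$ be a finite field. A quiver $Q=(Q_0,Q_1)$ consists of a finite set $Q_0$ of vertices and a finite set $Q_1$ of arrows, each arrow $\alpha$ having a source $s(\alpha)$ and a target $t(\alpha)$ in $Q_0$; multiple arrows are allowed. $Q$ is acyclic if it has no oriented cycles. Paths are written left to right ($cp$ means first $c$, then $p$). For a vertex $i$, $P_Q(i)$ is the indecomposable projective representation of $Q$ over $\mathbb{k}$ at $i$: its space at vertex $j$ has as basis the set of all paths from $i$ to $j$ (including the constant path $e_i$ if $j=i$), and an arrow $\alpha:j\to k$ acts by $c\mapsto c\alpha$. For a summand vector $\mathbf{d}\in\mathbb{Z}_{\geq 0}^{Q_0}$, $P_{Q,\mathbf{d}}:=\bigoplus_{i\in Q_0}P_Q(i)^{d_i}$ and $A_{Q,\mathbf{d}}:=\operatorname{End}(P_{Q,\mathbf{d}})$ is its endomorphism algebra in the category of representations of $Q$ over $\mathbb{k}$. $\operatorname{rad}$ denotes the Jacobson radical. The count $[Q,\mathbf{d}]$ is the number of pairs $(x,y)\in\operatorname{rad}A_{Q,\mathbf{d}}\times\operatorname{rad}A_{Q,\mathbf{d}}$ with $xy=yx$. *)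

theory Defs
  imports "HOL-Algebra.Module" "HOL-Algebra.AbelCoset" "Graph_Theory.Arc_Walk"
begin

text \<open>
  A quiver is a finite directed multigraph, i.e. a \<open>fin_digraph\<close>; loops and parallel arrows
  are allowed. A path from \<open>i\<close> to \<open>j\<close> is an arc walk, read left to right; the constant path
  at \<open>i\<close> is the empty walk.
\<close>

definition acyclic_quiver :: "('v, 'a) pre_digraph \<Rightarrow> bool" where
  "acyclic_quiver Q \<longleftrightarrow> \<not> (\<exists>i p. pre_digraph.awalk Q i p i \<and> p \<noteq> [])"

definition op_quiver :: "('v, 'a) pre_digraph \<Rightarrow> ('v, 'a) pre_digraph" where
  "op_quiver Q = \<lparr>verts = verts Q, arcs = arcs Q, tail = head Q, head = tail Q\<rparr>"

definition paths :: "('v, 'a) pre_digraph \<Rightarrow> 'v \<Rightarrow> 'v \<Rightarrow> 'a list set" where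
  "paths Q i j = {p. pre_digraph.awalk Q i p j}"


section \<open>Representations of a quiver\<close>

text \<open>
  Vector spaces over a field \<open>K\<close> are modules in the sense of HOL-Algebra. Module records extend
  ring records; the components \<open>mult\<close> and \<open>one\<close> play no role for a vector space and are left
  unspecified.
\<close>

definition linear_maps ::
  "('k, 'r) ring_scheme \<Rightarrow> ('k, 'm) module \<Rightarrow> ('k, 'n) module \<Rightarrow> ('m \<Rightarrow> 'n) set" where
  "linear_maps K M N = {f. f ` carrier M \<subseteq> carrier N \<and>
     (\<forall>x\<in>carrier M. \<forall>y\<in>carrier M. f (x \<oplus>\<^bsub>M\<^esub> y) = f x \<oplus>\<^bsub>N\<^esub> f y) \<and>
     (\<forall>c\<in>carrier K. \<forall>x\<in>carrier M. f (c \<odot>\<^bsub>M\<^esub> x) = c \<odot>\<^bsub>N\<^esub> f x)}"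

record ('v, 'a, 'k, 'm) quiver_rep =
  rep_space :: "'v \<Rightarrow> ('k, 'm) module"
  rep_map :: "'a \<Rightarrow> 'm \<Rightarrow> 'm"

locale quiver_representation = field K + Q: fin_digraph Q
  for K :: "('k, 'r) ring_scheme" (structure)
    and Q :: "('v, 'a) pre_digraph"
    and V :: "('v, 'a, 'k, 'm) quiver_rep" +
  assumes rep_space_module: "i \<in> verts Q \<Longrightarrow> Module.module K (rep_space V i)"
    and rep_map_linear: "a \<in> arcs Q \<Longrightarrow>
      rep_map V a \<in> linear_maps K (rep_space V (tail Q a)) (rep_space V (head Q a))"

text \<open>
  Morphisms are families of extensional functions, so that two morphisms are equal as soon as
  they agree at all vertices and on all vectors.
\<close>

definition rep_hom ::
  "('k, 'r) ring_scheme \<Rightarrow> ('v, 'a) pre_digraph \<Rightarrow>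
   ('v, 'a, 'k, 'm) quiver_rep \<Rightarrow> ('v, 'a, 'k, 'n) quiver_rep \<Rightarrow> ('v \<Rightarrow> 'm \<Rightarrow> 'n) set" where
  "rep_hom K Q V W =
     {f \<in> (\<Pi>\<^sub>E i\<in>verts Q. linear_maps K (rep_space V i) (rep_space W i)
                          \<inter> extensional (carrier (rep_space V i))).
      \<forall>a\<in>arcs Q. \<forall>x\<in>carrier (rep_space V (tail Q a)).
        f (head Q a) (rep_map V a x) = rep_map W a (f (tail Q a) x)}"

definition End_algebra ::
  "('k, 'r) ring_scheme \<Rightarrow> ('v, 'a) pre_digraph \<Rightarrow> ('v, 'a, 'k, 'm) quiver_rep \<Rightarrow>
   ('k, 'v \<Rightarrow> 'm \<Rightarrow> 'm) module" where
  "End_algebra K Q V =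
     \<lparr>carrier = rep_hom K Q V V,
      mult = (\<lambda>f g. \<lambda>i\<in>verts Q. compose (carrier (rep_space V i)) (f i) (g i)),
      one = (\<lambda>i\<in>verts Q. \<lambda>x\<in>carrier (rep_space V i). x),
      zero = (\<lambda>i\<in>verts Q. \<lambda>x\<in>carrier (rep_space V i). \<zero>\<^bsub>rep_space V i\<^esub>),
      add = (\<lambda>f g. \<lambda>i\<in>verts Q. \<lambda>x\<in>carrier (rep_space V i). f i x \<oplus>\<^bsub>rep_space V i\<^esub> g i x),
      smult = (\<lambda>c f. \<lambda>i\<in>verts Q. \<lambda>x\<in>carrier (rep_space V i). c \<odot>\<^bsub>rep_space V i\<^esub> f i x)\<rparr>"

text \<open>Direct sum of a family of representations over a finite index set.\<close>

definition direct_sum_rep ::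
  "'i set \<Rightarrow> ('i \<Rightarrow> ('v, 'a, 'k, 'm) quiver_rep) \<Rightarrow> ('v, 'a, 'k, 'i \<Rightarrow> 'm) quiver_rep" where
  "direct_sum_rep I V =
     \<lparr>rep_space = (\<lambda>j.
        \<lparr>carrier = (\<Pi>\<^sub>E s\<in>I. carrier (rep_space (V s) j)),
         mult = undefined, one = undefined,
         zero = (\<lambda>s\<in>I. \<zero>\<^bsub>rep_space (V s) j\<^esub>),
         add = (\<lambda>x y. \<lambda>s\<in>I. x s \<oplus>\<^bsub>rep_space (V s) j\<^esub> y s),
         smult = (\<lambda>c x. \<lambda>s\<in>I. c \<odot>\<^bsub>rep_space (V s) j\<^esub> x s)\<rparr>),
      rep_map = (\<lambda>a x. \<lambda>s\<in>I. rep_map (V s) a (x s))\<rparr>"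


section \<open>Projective representations\<close>

text \<open>The vector space with basis \<open>B\<close>: finitely supported coefficient functions on \<open>B\<close>.\<close>

definition free_space :: "('k, 'r) ring_scheme \<Rightarrow> 'b set \<Rightarrow> ('k, 'b \<Rightarrow> 'k) module" where
  "free_space K B =
     \<lparr>carrier = {x \<in> B \<rightarrow>\<^sub>E carrier K. finite {b \<in> B. x b \<noteq> \<zero>\<^bsub>K\<^esub>}},
      mult = undefined, one = undefined,
      zero = (\<lambda>b\<in>B. \<zero>\<^bsub>K\<^esub>),
      add = (\<lambda>x y. \<lambda>b\<in>B. x b \<oplus>\<^bsub>K\<^esub> y b),
      smult = (\<lambda>c x. \<lambda>b\<in>B. c \<otimes>\<^bsub>K\<^esub> x b)\<rparr>"

text \<open>
  \<open>P(i)\<close>: an arrow \<open>a\<close> sends the basis path \<open>c\<close> to \<open>c @ [a]\<close>. Extended linearly, the coefficient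
  of the image of \<open>x\<close> at a path \<open>q\<close> is that of \<open>x\<close> at \<open>c\<close> if \<open>q = c @ [a]\<close>, and zero if \<open>q\<close> does
  not end in \<open>a\<close>.
\<close>

definition proj_rep ::
  "('k, 'r) ring_scheme \<Rightarrow> ('v, 'a) pre_digraph \<Rightarrow> 'v \<Rightarrow> ('v, 'a, 'k, 'a list \<Rightarrow> 'k) quiver_rep" where
  "proj_rep K Q i =
     \<lparr>rep_space = (\<lambda>j. free_space K (paths Q i j)),
      rep_map = (\<lambda>a x. \<lambda>q\<in>paths Q i (head Q a).
        if \<exists>c. q = c @ [a] then x (butlast q) else \<zero>\<^bsub>K\<^esub>)\<rparr>"

definition proj_rep_sum ::
  "('k, 'r) ring_scheme \<Rightarrow> ('v, 'a) pre_digraph \<Rightarrow> ('v \<Rightarrow> nat) \<Rightarrow>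
   ('v, 'a, 'k, 'v \<times> nat \<Rightarrow> 'a list \<Rightarrow> 'k) quiver_rep" where
  "proj_rep_sum K Q d =
     direct_sum_rep (SIGMA i:verts Q. {..<d i}) (\<lambda>(i, m). proj_rep K Q i)"


section \<open>The Jacobson radical\<close>

definition left_ideal :: "'e set \<Rightarrow> ('e, 'r) ring_scheme \<Rightarrow> bool" where
  "left_ideal I R \<longleftrightarrow>
     additive_subgroup I R \<and> (\<forall>r\<in>carrier R. \<forall>x\<in>I. r \<otimes>\<^bsub>R\<^esub> x \<in> I)"

definition maximal_left_ideal :: "'e set \<Rightarrow> ('e, 'r) ring_scheme \<Rightarrow> bool" where
  "maximal_left_ideal I R \<longleftrightarrow> left_ideal I R \<and> I \<noteq> carrier R \<and>
     (\<forall>J. left_ideal J R \<and> I \<subseteq> J \<longrightarrow> J = I \<or> J = carrier R)"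

text \<open>
  The intersection of all maximal left ideals; it is taken inside the carrier, so that the
  radical of the zero ring, which has no maximal left ideals, is the zero ring.
\<close>

definition jacobson_radical :: "('e, 'r) ring_scheme \<Rightarrow> 'e set" where
  "jacobson_radical R = {x \<in> carrier R. \<forall>I. maximal_left_ideal I R \<longrightarrow> x \<in> I}"


section \<open>The count of commuting pairs\<close>

definition commuting_pairs_count ::
  "('k, 'r) ring_scheme \<Rightarrow> ('v, 'a) pre_digraph \<Rightarrow> ('v \<Rightarrow> nat) \<Rightarrow> nat" where
  "commuting_pairs_count K Q d =
     (let A = End_algebra K Q (proj_rep_sum K Q d); J = jacobson_radical A
      in card {(x, y) \<in> J \<times> J. x \<otimes>\<^bsub>A\<^esub> y = y \<otimes>\<^bsub>A\<^esub> x})"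


section \<open>Well-definedness\<close>

lemma fin_digraph_op_quiver: "fin_digraph Q \<Longrightarrow> fin_digraph (op_quiver Q)"
  by (auto simp: op_quiver_def fin_digraph_def wf_digraph_def fin_digraph_axioms_def)

context fixes K :: "('k, 'r) ring_scheme" (structure) assumes K: "field K"
begin

interpretation field K by (rule K)

lemma free_space_module: "Module.module K (free_space K B)"
proof (intro moduleI abelian_groupI)
  have memI: "(\<lambda>b\<in>B. h b) \<in> carrier (free_space K B)"
    if "x \<in> carrier (free_space K B)" "y \<in> carrier (free_space K B)"
       "\<And>b. b \<in> B \<Longrightarrow> h b \<in> carrier K"
       "\<And>b. b \<in> B \<Longrightarrow> x b = \<zero> \<Longrightarrow> y b = \<zero> \<Longrightarrow> h b = \<zero>" for x y h
  proof -
    have "finite {b \<in> B. (\<lambda>b\<in>B. h b) b \<noteq> \<zero>}"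
      by (rule finite_subset[of _ "{b \<in> B. x b \<noteq> \<zero>} \<union> {b \<in> B. y b \<noteq> \<zero>}"])
         (use that in \<open>auto simp: free_space_def\<close>)
    then show ?thesis using that(3) by (simp add: free_space_def)
  qed
  have val: "x b \<in> carrier K" if "x \<in> carrier (free_space K B)" "b \<in> B" for x b
    using that by (auto simp: free_space_def)
  show "x \<oplus>\<^bsub>free_space K B\<^esub> y \<in> carrier (free_space K B)"
    if "x \<in> carrier (free_space K B)" "y \<in> carrier (free_space K B)" for x y
    using memI[OF that, of "\<lambda>b. x b \<oplus> y b"] that by (simp add: val) (simp add: free_space_def)
  show "c \<odot>\<^bsub>free_space K B\<^esub> x \<in> carrier (free_space K B)"
    if "c \<in> carrier K" "x \<in> carrier (free_space K B)" for c x
    using memI[OF that(2,2), of "\<lambda>b. c \<otimes> x b"] that by (simp add: val) (simp add: free_space_def)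
  show "\<exists>y\<in>carrier (free_space K B). y \<oplus>\<^bsub>free_space K B\<^esub> x = \<zero>\<^bsub>free_space K B\<^esub>"
    if "x \<in> carrier (free_space K B)" for x
  proof -
    have "(\<lambda>b\<in>B. \<ominus> x b) \<in> carrier (free_space K B)"
      using memI[OF \<open>x \<in> _\<close> \<open>x \<in> _\<close>, of "\<lambda>b. \<ominus> x b"] \<open>x \<in> _\<close> by (simp add: val)
    moreover have "(\<lambda>b\<in>B. \<ominus> x b) \<oplus>\<^bsub>free_space K B\<^esub> x = \<zero>\<^bsub>free_space K B\<^esub>"
      by (simp add: free_space_def fun_eq_iff val[OF \<open>x \<in> _\<close>] l_neg)
    ultimately show ?thesis by blast
  qed
  show "cring K" by (rule is_cring)
qed (auto simp: free_space_def fun_eq_iff PiE_iff extensional_def Ball_def a_ac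
       l_distr r_distr m_assoc)

lemma direct_sum_module:
  assumes "\<And>s. s \<in> I \<Longrightarrow> Module.module K (rep_space (V s) j)"
  shows "Module.module K (rep_space (direct_sum_rep I V) j)"
proof -
  note M = assms
  have A: "abelian_group (rep_space (V s) j)" if "s \<in> I" for s
    using M[OF that] by (simp add: Module.module_def)
  show ?thesis
  proof (intro moduleI abelian_groupI)
    let ?M = "rep_space (direct_sum_rep I V) j"
    show "\<exists>y\<in>carrier ?M. y \<oplus>\<^bsub>?M\<^esub> x = \<zero>\<^bsub>?M\<^esub>" if "x \<in> carrier ?M" for x
    proof -
      have "\<And>s. s \<in> I \<Longrightarrow> x s \<in> carrier (rep_space (V s) j)"
        using that by (auto simp: direct_sum_rep_def)
      with A show ?thesis
        by (intro bexI[of _ "\<lambda>s\<in>I. \<ominus>\<^bsub>rep_space (V s) j\<^esub> x s"])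
           (auto simp: direct_sum_rep_def fun_eq_iff abelian_group.a_inv_closed abelian_group.l_neg)
    qed
    show "cring K" by (rule is_cring)
  qed (use A[THEN abelian_group.axioms(1)] in \<open>auto simp: direct_sum_rep_def fun_eq_iff PiE_iff
         extensional_def abelian_monoid.a_closed abelian_monoid.zero_closed abelian_monoid.a_ac
         abelian_monoid.r_zero Module.module.smult_closed[OF M] Module.module.smult_l_distr[OF M]
         Module.module.smult_r_distr[OF M] Module.module.smult_assoc1[OF M] Module.module.smult_one[OF M]\<close>)
qed

end

lemma paths_snoc:
  "c @ [a] \<in> paths Q i j \<longleftrightarrow> c \<in> paths Q i (tail Q a) \<and> a \<in> arcs Q \<and> head Q a = j"
proof -
  have "pre_digraph.cas Q i (c @ [a]) j \<longleftrightarrow> pre_digraph.cas Q i c (tail Q a) \<and> head Q a = j"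
    by (induction c arbitrary: i) (auto simp: pre_digraph.cas.simps)
  then show ?thesis by (auto simp: paths_def pre_digraph.awalk_def)
qed

lemma quiver_representation_proj:
  assumes "field K" "fin_digraph Q"
  shows "quiver_representation K Q (proj_rep K Q i)"
proof -
  interpret field K by fact
  interpret Q: fin_digraph Q by fact
  show ?thesis
  proof (intro quiver_representation.intro quiver_representation_axioms.intro assms)
    show "Module.module K (rep_space (proj_rep K Q i) j)" for j
      by (simp add: proj_rep_def free_space_module[OF assms(1)])
  next
    fix a assume "a \<in> arcs Q"
    let ?M = "\<lambda>j. free_space K (paths Q i j)"
    let ?f = "\<lambda>x. \<lambda>q\<in>paths Q i (head Q a). if \<exists>c. q = c @ [a] then x (butlast q) else \<zero>\<^bsub>K\<^esub>"
    have "?f x \<in> carrier (?M (head Q a))" if x: "x \<in> carrier (?M (tail Q a))" for x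
    proof -
      have "finite {c \<in> paths Q i (tail Q a). x c \<noteq> \<zero>\<^bsub>K\<^esub>}"
        using x by (simp add: free_space_def)
      then have "finite {q \<in> paths Q i (head Q a). ?f x q \<noteq> \<zero>\<^bsub>K\<^esub>}"
        by (rule finite_subset[OF _ finite_imageI[of _ "\<lambda>c. c @ [a]"], rotated])
           (auto simp: paths_snoc split: if_splits)
      then show ?thesis
        using x by (auto simp: free_space_def paths_snoc PiE_iff)
    qed
    then have "?f \<in> linear_maps K (?M (tail Q a)) (?M (head Q a))"
      unfolding linear_maps_def
      by (auto simp: image_subset_iff) (auto simp: free_space_def fun_eq_iff paths_snoc)
    then show "rep_map (proj_rep K Q i) a \<in> linear_maps K
        (rep_space (proj_rep K Q i) (tail Q a)) (rep_space (proj_rep K Q i) (head Q a))"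
      by (simp add: proj_rep_def)
  qed
qed

lemma quiver_representation_direct_sum:
  assumes "field K" "fin_digraph Q" "\<And>s. s \<in> I \<Longrightarrow> quiver_representation K Q (V s)"
  shows "quiver_representation K Q (direct_sum_rep I V)"
proof -
  interpret field K by fact
  interpret Q: fin_digraph Q by fact
  show ?thesis
  proof (intro quiver_representation.intro quiver_representation_axioms.intro assms)
    show "Module.module K (rep_space (direct_sum_rep I V) j)" if "j \<in> verts Q" for j
      using that assms by (intro direct_sum_module) (auto intro: quiver_representation.rep_space_module)
  next
    fix a assume "a \<in> arcs Q"
    then have "rep_map (V s) a \<in> linear_maps K (rep_space (V s) (tail Q a)) (rep_space (V s) (head Q a))"
      if "s \<in> I" for s
      using quiver_representation.rep_map_linear[OF assms(3)] that by blast
    then show "rep_map (direct_sum_rep I V) a \<in> linear_maps K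
        (rep_space (direct_sum_rep I V) (tail Q a)) (rep_space (direct_sum_rep I V) (head Q a))"
      by (simp add: direct_sum_rep_def linear_maps_def fun_eq_iff PiE_iff image_subset_iff)
  qed
qed

lemma quiver_representation_proj_sum:
  assumes "field K" "fin_digraph Q"
  shows "quiver_representation K Q (proj_rep_sum K Q d)"
  unfolding proj_rep_sum_def
  by (rule quiver_representation_direct_sum)
     (use assms quiver_representation_proj in \<open>auto split: prod.splits\<close>)

lemma (in quiver_representation) End_algebra_ring: "ring (End_algebra K Q V)"
proof -
  let ?A = "End_algebra K Q V" and ?C = "\<lambda>i. carrier (rep_space V i)"
  note M = rep_space_module
  have G: "abelian_group (rep_space V i)" if "i \<in> verts Q" for i
    using M[OF that] by (simp add: Module.module_def)
  note G' = G[THEN abelian_group.axioms(1)]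
  have map: "\<And>a x. a \<in> arcs Q \<Longrightarrow> x \<in> ?C (tail Q a) \<Longrightarrow> rep_map V a x \<in> ?C (head Q a)"
    "\<And>a x y. a \<in> arcs Q \<Longrightarrow> x \<in> ?C (tail Q a) \<Longrightarrow> y \<in> ?C (tail Q a) \<Longrightarrow>
       rep_map V a (x \<oplus>\<^bsub>rep_space V (tail Q a)\<^esub> y) =
       rep_map V a x \<oplus>\<^bsub>rep_space V (head Q a)\<^esub> rep_map V a y"
    "\<And>a c x. a \<in> arcs Q \<Longrightarrow> c \<in> carrier K \<Longrightarrow> x \<in> ?C (tail Q a) \<Longrightarrow>
       rep_map V a (c \<odot>\<^bsub>rep_space V (tail Q a)\<^esub> x) = c \<odot>\<^bsub>rep_space V (head Q a)\<^esub> rep_map V a x"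
    using rep_map_linear by (auto simp: linear_maps_def image_subset_iff)
  have A1: "f i x \<in> ?C i" if "f \<in> carrier ?A" "i \<in> verts Q" "x \<in> ?C i" for f i x
    using that by (auto simp: End_algebra_def rep_hom_def linear_maps_def PiE_iff image_subset_iff)
  have A2: "f i (x \<oplus>\<^bsub>rep_space V i\<^esub> y) = f i x \<oplus>\<^bsub>rep_space V i\<^esub> f i y"
    if "f \<in> carrier ?A" "i \<in> verts Q" "x \<in> ?C i" "y \<in> ?C i" for f i x y
    using that by (auto simp: End_algebra_def rep_hom_def linear_maps_def PiE_iff)
  have A3: "f i (c \<odot>\<^bsub>rep_space V i\<^esub> x) = c \<odot>\<^bsub>rep_space V i\<^esub> f i x"
    if "f \<in> carrier ?A" "i \<in> verts Q" "c \<in> carrier K" "x \<in> ?C i" for f i x c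
    using that by (auto simp: End_algebra_def rep_hom_def linear_maps_def PiE_iff)
  have A4: "f (head Q a) (rep_map V a x) = rep_map V a (f (tail Q a) x)"
    if "f \<in> carrier ?A" "a \<in> arcs Q" "x \<in> ?C (tail Q a)" for f a x
    using that by (auto simp: End_algebra_def rep_hom_def)
  have ext: "f = g" if "f \<in> carrier ?A" "g \<in> carrier ?A" and eq: "\<And>i x. i \<in> verts Q \<Longrightarrow> x \<in> ?C i \<Longrightarrow> f i x = g i x"
    for f g
  proof (rule PiE_ext)
    show fg: "f \<in> (\<Pi>\<^sub>E i\<in>verts Q. extensional (?C i))" "g \<in> (\<Pi>\<^sub>E i\<in>verts Q. extensional (?C i))"
      using that(1,2) by (auto simp: End_algebra_def rep_hom_def PiE_def)
    show "f i = g i" if "i \<in> verts Q" for i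
      using fg that eq by (intro extensionalityI[of _ "?C i"]) auto
  qed
  have I: "(\<lambda>i\<in>verts Q. \<lambda>x\<in>?C i. h i x) \<in> carrier ?A"
    if "\<And>i x. i \<in> verts Q \<Longrightarrow> x \<in> ?C i \<Longrightarrow> h i x \<in> ?C i"
      "\<And>i x y. i \<in> verts Q \<Longrightarrow> x \<in> ?C i \<Longrightarrow> y \<in> ?C i \<Longrightarrow>
         h i (x \<oplus>\<^bsub>rep_space V i\<^esub> y) = h i x \<oplus>\<^bsub>rep_space V i\<^esub> h i y"
      "\<And>i c x. i \<in> verts Q \<Longrightarrow> c \<in> carrier K \<Longrightarrow> x \<in> ?C i \<Longrightarrow>
         h i (c \<odot>\<^bsub>rep_space V i\<^esub> x) = c \<odot>\<^bsub>rep_space V i\<^esub> h i x"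
      "\<And>a x. a \<in> arcs Q \<Longrightarrow> x \<in> ?C (tail Q a) \<Longrightarrow>
         h (head Q a) (rep_map V a x) = rep_map V a (h (tail Q a) x)" for h
    using that map(1) abelian_monoid.a_closed[OF G'] Module.module.smult_closed[OF M]
    by (auto simp: End_algebra_def rep_hom_def linear_maps_def PiE_iff)
  have mult: "f \<otimes>\<^bsub>?A\<^esub> g \<in> carrier ?A" if "f \<in> carrier ?A" "g \<in> carrier ?A" for f g
    using I[of "\<lambda>i x. f i (g i x)"] that
    by (simp add: A1 A2 A3 A4 End_algebra_def[of K Q V, THEN arg_cong[of _ _ mult]] compose_def)
  have add: "f \<oplus>\<^bsub>?A\<^esub> g \<in> carrier ?A" if "f \<in> carrier ?A" "g \<in> carrier ?A" for f g
    using I[of "\<lambda>i x. f i x \<oplus>\<^bsub>rep_space V i\<^esub> g i x"] that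
    by (simp add: A1 A2 A3 A4 map End_algebra_def[of K Q V, THEN arg_cong[of _ _ add]]
          abelian_monoid.a_closed[OF G'] abelian_monoid.a_ac[OF G'] Module.module.smult_r_distr[OF M])
  have one: "\<one>\<^bsub>?A\<^esub> \<in> carrier ?A"
    using I[of "\<lambda>i x. x"] by (simp add: End_algebra_def)
  have smult: "(\<lambda>i\<in>verts Q. \<lambda>x\<in>?C i. c \<odot>\<^bsub>rep_space V i\<^esub> f i x) \<in> carrier ?A"
    if "c \<in> carrier K" "f \<in> carrier ?A" for c f
    using that
    by (intro I) (simp_all add: A1 A2 A3 A4 map Module.module.smult_closed[OF M]
        Module.module.smult_r_distr[OF M] Module.module.smult_assoc1[OF M, symmetric] m_comm)
  have zero: "\<zero>\<^bsub>?A\<^esub> \<in> carrier ?A"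
    using smult[OF zero_closed one]
    by (simp add: End_algebra_def Module.module.smult_l_null[OF M] cong: restrict_cong)
  have val: "i \<in> verts Q \<Longrightarrow> x \<in> ?C i \<Longrightarrow> (f \<oplus>\<^bsub>?A\<^esub> g) i x = f i x \<oplus>\<^bsub>rep_space V i\<^esub> g i x"
    "i \<in> verts Q \<Longrightarrow> x \<in> ?C i \<Longrightarrow> (f \<otimes>\<^bsub>?A\<^esub> g) i x = f i (g i x)"
    "i \<in> verts Q \<Longrightarrow> x \<in> ?C i \<Longrightarrow> \<one>\<^bsub>?A\<^esub> i x = x"
    "i \<in> verts Q \<Longrightarrow> x \<in> ?C i \<Longrightarrow> \<zero>\<^bsub>?A\<^esub> i x = \<zero>\<^bsub>rep_space V i\<^esub>" for f g i x
    by (simp_all add: End_algebra_def compose_def)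
  have neg: "\<exists>g\<in>carrier ?A. g \<oplus>\<^bsub>?A\<^esub> f = \<zero>\<^bsub>?A\<^esub>" if "f \<in> carrier ?A" for f
  proof
    let ?g = "\<lambda>i\<in>verts Q. \<lambda>x\<in>?C i. (\<ominus> \<one>) \<odot>\<^bsub>rep_space V i\<^esub> f i x"
    show g: "?g \<in> carrier ?A" using that by (intro smult) auto
    have "(\<ominus> \<one>) \<odot>\<^bsub>rep_space V i\<^esub> x \<oplus>\<^bsub>rep_space V i\<^esub> x = \<zero>\<^bsub>rep_space V i\<^esub>"
      if "i \<in> verts Q" "x \<in> ?C i" for i x
      using Module.module.smult_l_distr[OF M, of i "\<ominus> \<one>" \<one> x] that
      by (simp add: Module.module.smult_one[OF M] Module.module.smult_l_null[OF M] l_neg)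
    then show "?g \<oplus>\<^bsub>?A\<^esub> f = \<zero>\<^bsub>?A\<^esub>"
      using that by (intro ext add g zero) (simp_all add: val A1)
  qed
  show ?thesis
  proof (intro ringI abelian_groupI monoidI)
  qed (auto intro!: ext mult add one zero neg
         simp: val A1 A2 abelian_monoid.a_closed[OF G'] abelian_monoid.a_ac[OF G'] abelian_monoid.l_zero[OF G']
           abelian_monoid.r_zero[OF G'])
qed

end

theory Submission
  imports Defs
begin

text \<open>
  The image of the generator (the constant path) of the summand \<open>s\<close> turns an endomorphism of
  the projective into a matrix whose entry at \<open>(s, t)\<close> is a combination of paths from \<open>t\<close> to \<open>s\<close>, and
  composition becomes matrix multiplication over the path algebra. Transposing matrices and
  reversing paths is therefore an anti-isomorphism onto the endomorphism algebra for the opposite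
  quiver. The Jacobson radical consists of the \<open>x\<close> for which all \<open>1 - r x\<close> are units, and \<open>1 - r x\<close>
  is a unit iff \<open>1 - x r\<close> is; so anti-isomorphisms preserve the radical and, with it, the number
  of commuting pairs.
\<close>

section \<open>The Jacobson radical\<close>

text \<open>The radical is defined through maximal left ideals, and an anti-isomorphism sends left
  ideals to right ideals, so it cannot be transported directly. Being a unit is a two-sided notion;
  what then remains is the order of the factors in 1 - r x, and swapping them is an identity about
  inverses. On the side of representations, acyclicity makes all path sets finite, so each space of
  the projective has a finite basis of pairs (summand, path) and linearity reduces an endomorphism
  to coefficients. Three things together reverse products: transposition exchanges rows and columns,
  reversing a path exchanges the two pieces of each factorization, and the scalars commute because
  they lie in a field.\<close>

context ring
begin

section \<open>Left ideals and maximal left ideals\<close>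

lemma left_idealD:
  assumes "left_ideal I R"
  shows "I \<subseteq> carrier R" "\<zero> \<in> I" "x \<in> I \<Longrightarrow> y \<in> I \<Longrightarrow> x \<oplus> y \<in> I"
    "r \<in> carrier R \<Longrightarrow> x \<in> I \<Longrightarrow> r \<otimes> x \<in> I"
proof -
  have I: "additive_subgroup I R" using assms by (simp add: left_ideal_def)
  show "I \<subseteq> carrier R" by (rule additive_subgroup.a_subset[OF I])
  show "\<zero> \<in> I" by (rule additive_subgroup.zero_closed[OF I])
  show "x \<in> I \<Longrightarrow> y \<in> I \<Longrightarrow> x \<oplus> y \<in> I" by (rule additive_subgroup.a_closed[OF I])
  show "r \<in> carrier R \<Longrightarrow> x \<in> I \<Longrightarrow> r \<otimes> x \<in> I" using assms by (simp add: left_ideal_def)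
qed

lemma left_idealI:
  assumes "I \<subseteq> carrier R" "\<zero> \<in> I" "\<And>x y. x \<in> I \<Longrightarrow> y \<in> I \<Longrightarrow> x \<oplus> y \<in> I"
    and smult: "\<And>r x. r \<in> carrier R \<Longrightarrow> x \<in> I \<Longrightarrow> r \<otimes> x \<in> I"
  shows "left_ideal I R"
proof -
  have "\<ominus> x \<in> I" if "x \<in> I" for x
    using smult[of "\<ominus> \<one>" x] that assms(1) by (auto simp: l_minus)
  then have "additive_subgroup I R"
    using assms(1-3) by (intro additive_subgroupI group.subgroupI[OF a_group]) (auto simp: a_inv_def)
  then show ?thesis using smult by (auto simp: left_ideal_def)
qed

lemma left_ideal_eq_carrier:
  assumes "left_ideal I R" "\<one> \<in> I"
  shows "I = carrier R"
proof
  show "I \<subseteq> carrier R" by (rule left_idealD(1)[OF assms(1)])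
  show "carrier R \<subseteq> I"
  proof
    fix r assume "r \<in> carrier R"
    then show "r \<in> I" using left_idealD(4)[OF assms(1) _ assms(2), of r] by simp
  qed
qed

text \<open>This is I + R a. It serves twice: with I zero it is the principal left ideal of
  \<open>a\<close>, and with I maximal it enlarges I by an outside element.\<close>

lemma left_ideal_cyclic_sum:
  assumes "left_ideal I R" "a \<in> carrier R"
  shows "left_ideal {m \<oplus> r \<otimes> a | m r. m \<in> I \<and> r \<in> carrier R} R"
proof (rule left_idealI)
  note I = left_idealD[OF assms(1)]
  have c: "m \<in> I \<Longrightarrow> m \<in> carrier R" for m using I(1) by auto
  show "{m \<oplus> r \<otimes> a | m r. m \<in> I \<and> r \<in> carrier R} \<subseteq> carrier R"
    using c assms(2) by auto
  have "\<zero> = \<zero> \<oplus> \<zero> \<otimes> a" using assms(2) by simp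
  then show "\<zero> \<in> {m \<oplus> r \<otimes> a | m r. m \<in> I \<and> r \<in> carrier R}" using I(2) by blast
next
  note I = left_idealD[OF assms(1)]
  have c: "m \<in> I \<Longrightarrow> m \<in> carrier R" for m using I(1) by auto
  fix x y assume "x \<in> {m \<oplus> r \<otimes> a | m r. m \<in> I \<and> r \<in> carrier R}"
    "y \<in> {m \<oplus> r \<otimes> a | m r. m \<in> I \<and> r \<in> carrier R}"
  then obtain m r m' r' where *: "m \<in> I" "r \<in> carrier R" "x = m \<oplus> r \<otimes> a"
    "m' \<in> I" "r' \<in> carrier R" "y = m' \<oplus> r' \<otimes> a" by blast
  then have "x \<oplus> y = (m \<oplus> m') \<oplus> (r \<oplus> r') \<otimes> a"
    using assms(2) c by (simp add: l_distr a_ac)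
  then show "x \<oplus> y \<in> {m \<oplus> r \<otimes> a | m r. m \<in> I \<and> r \<in> carrier R}" using * I(3) by blast
next
  note I = left_idealD[OF assms(1)]
  have c: "m \<in> I \<Longrightarrow> m \<in> carrier R" for m using I(1) by auto
  fix s x assume s: "s \<in> carrier R" and "x \<in> {m \<oplus> r \<otimes> a | m r. m \<in> I \<and> r \<in> carrier R}"
  then obtain m r where *: "m \<in> I" "r \<in> carrier R" "x = m \<oplus> r \<otimes> a" by blast
  then have "s \<otimes> x = s \<otimes> m \<oplus> (s \<otimes> r) \<otimes> a"
    using assms(2) c s by (simp add: r_distr m_assoc)
  then show "s \<otimes> x \<in> {m \<oplus> r \<otimes> a | m r. m \<in> I \<and> r \<in> carrier R}" using * s I(4) by blast
qed

text \<open>Zorn's lemma is applied to the left ideals that avoid \<open>\<one>\<close>: this form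
  of properness visibly survives unions of chains. A left ideal above the resulting M either avoids
  \<open>\<one>\<close>, hence equals M, or contains it and is everything.\<close>

lemma ex_maximal_left_ideal:
  assumes L: "left_ideal L R" "\<one> \<notin> L"
  obtains M where "maximal_left_ideal M R" "L \<subseteq> M"
proof -
  let ?S = "{J. left_ideal J R \<and> L \<subseteq> J \<and> \<one> \<notin> J}"
  have "\<exists>M\<in>?S. \<forall>X\<in>?S. M \<subseteq> X \<longrightarrow> X = M"
  proof (rule subset_Zorn_nonempty)
    show "?S \<noteq> {}" using L by blast
    fix C assume C: "C \<noteq> {}" "subset.chain ?S C"
    then have l: "left_ideal J R" "L \<subseteq> J" "\<one> \<notin> J" if "J \<in> C" for J
      using that by (auto simp: subset.chain_def)
    have "left_ideal (\<Union> C) R"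
    proof (rule left_idealI)
      fix x y assume "x \<in> \<Union> C" "y \<in> \<Union> C"
      then obtain X Y where XY: "X \<in> C" "Y \<in> C" "x \<in> X" "y \<in> Y" by blast
      then have "X \<subseteq> Y \<or> Y \<subseteq> X"
        using C(2) by (auto simp: subset_chain_def)
      then show "x \<oplus> y \<in> \<Union> C"
        using XY left_idealD(3)[OF l(1)] by blast
    next
      show "\<Union> C \<subseteq> carrier R" using left_idealD(1)[OF l(1)] by blast
      show "\<zero> \<in> \<Union> C" using C(1) left_idealD(2)[OF l(1)] by blast
    next
      fix r x assume "r \<in> carrier R" "x \<in> \<Union> C"
      then show "r \<otimes> x \<in> \<Union> C" using left_idealD(4)[OF l(1)] by blast
    qed
    then show "\<Union> C \<in> ?S" using C(1) l by blast
  qed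
  then obtain M where "M \<in> ?S" and "\<forall>X\<in>?S. M \<subseteq> X \<longrightarrow> X = M" by (rule bexE)
  then have M: "left_ideal M R" "L \<subseteq> M" "\<one> \<notin> M"
    and max: "\<And>X. left_ideal X R \<Longrightarrow> L \<subseteq> X \<Longrightarrow> \<one> \<notin> X \<Longrightarrow> M \<subseteq> X \<Longrightarrow> X = M" by simp_all
  have "maximal_left_ideal M R"
    unfolding maximal_left_ideal_def
  proof (intro conjI allI impI M(1))
    show "M \<noteq> carrier R" using M(3) by auto
    fix J assume "left_ideal J R \<and> M \<subseteq> J"
    then show "J = M \<or> J = carrier R"
      using max[of J] M(2) left_ideal_eq_carrier[of J] by auto
  qed
  with M(2) show thesis by (rule that[rotated])
qed

section \<open>The radical in terms of units\<close>

text \<open>Without a left inverse, the principal left ideal of 1 - r x would be proper and so lie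
  in some maximal left ideal M. But M contains x, hence r x, and therefore 1.\<close>

lemma jacobson_radical_left_inverse:
  assumes x: "x \<in> jacobson_radical R" and r: "r \<in> carrier R"
  obtains s where "s \<in> carrier R" "s \<otimes> (\<one> \<ominus> r \<otimes> x) = \<one>"
proof -
  have xc: "x \<in> carrier R" using x by (simp add: jacobson_radical_def)
  let ?a = "\<one> \<ominus> r \<otimes> x"
  have a: "?a \<in> carrier R" using xc r by simp
  let ?L = "{m \<oplus> s \<otimes> ?a | m s. m \<in> {\<zero>} \<and> s \<in> carrier R}"
  have L: "left_ideal ?L R"
    by (intro left_ideal_cyclic_sum left_idealI a) auto
  have "\<one> \<in> ?L"
  proof (rule ccontr)
    assume "\<one> \<notin> ?L"
    then obtain M where M: "maximal_left_ideal M R" "?L \<subseteq> M"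
      using ex_maximal_left_ideal[OF L] by blast
    then have Ml: "left_ideal M R" by (simp add: maximal_left_ideal_def)
    have "?a = \<zero> \<oplus> \<one> \<otimes> ?a" using a by simp
    then have "?a \<in> ?L" by blast
    moreover have "x \<in> M" using x M(1) by (simp add: jacobson_radical_def)
    ultimately have "?a \<oplus> r \<otimes> x \<in> M"
      using M(2) r by (intro left_idealD(3,4)[OF Ml]) blast+
    also have "?a \<oplus> r \<otimes> x = \<one>" using xc r by (simp add: minus_eq a_assoc l_neg)
    finally show False using left_ideal_eq_carrier[OF Ml] M(1) by (auto simp: maximal_left_ideal_def)
  qed
  then obtain s where "s \<in> carrier R" "\<one> = \<zero> \<oplus> s \<otimes> ?a" by blast
  then show thesis using that[of s] a by simp
qed

text \<open>Forward, a one-sided inverse is upgraded by applying the previous lemma a second time,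
  to the inverse itself. Backward, if x is outside a maximal M, then M + R x is everything, so 1 = m
  + r x with m in M; the unit 1 - r x is then this m, which is absurd.\<close>

lemma jacobson_radical_iff_Units:
  "x \<in> jacobson_radical R \<longleftrightarrow> x \<in> carrier R \<and> (\<forall>r\<in>carrier R. \<one> \<ominus> r \<otimes> x \<in> Units R)"
proof (intro iffI conjI ballI)
  assume x: "x \<in> jacobson_radical R"
  then show xc: "x \<in> carrier R" by (simp add: jacobson_radical_def)
  fix r assume r: "r \<in> carrier R"
  obtain s where s: "s \<in> carrier R" "s \<otimes> (\<one> \<ominus> r \<otimes> x) = \<one>"
    using jacobson_radical_left_inverse[OF x r] .
  \<comment> \<open>The left inverse \<open>s\<close> again has the form \<open>\<one> \<ominus> r' \<otimes> x\<close>.\<close>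
  have "s \<ominus> s \<otimes> (r \<otimes> x) = \<one>"
    using s xc r by (simp add: minus_eq r_distr r_minus)
  then have "s = \<one> \<oplus> s \<otimes> (r \<otimes> x)"
    using s(1) xc r by (metis m_closed minus_eq a_inv_closed a_assoc l_neg r_zero)
  then have s_eq: "s = \<one> \<ominus> (\<ominus> (s \<otimes> r)) \<otimes> x"
    using s(1) xc r by (simp add: minus_eq l_minus m_assoc)
  obtain t where t: "t \<in> carrier R" "t \<otimes> s = \<one>"
    using jacobson_radical_left_inverse[OF x, of "\<ominus> (s \<otimes> r)"] s_eq s(1) r by (metis a_inv_closed m_closed)
  \<comment> \<open>\<open>s\<close> has the left inverse \<open>t\<close> and the right inverse
    \<open>\<one> \<ominus> r \<otimes> x\<close>; the two must agree, so \<open>s\<close> is a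
    two-sided inverse.\<close>
  have "t = \<one> \<ominus> r \<otimes> x"
    using inv_unique[OF t(2) s(2)] s t xc r by simp
  then show "\<one> \<ominus> r \<otimes> x \<in> Units R"
    using s t unfolding Units_def by auto
next
  assume x: "x \<in> carrier R \<and> (\<forall>r\<in>carrier R. \<one> \<ominus> r \<otimes> x \<in> Units R)"
  have "x \<in> M" if M: "maximal_left_ideal M R" for M
  proof (rule ccontr)
    assume "x \<notin> M"
    have Ml: "left_ideal M R" and Mn: "M \<noteq> carrier R"
      and max: "\<And>J. left_ideal J R \<Longrightarrow> M \<subseteq> J \<Longrightarrow> J = M \<or> J = carrier R"
      using M by (auto simp: maximal_left_ideal_def)
    note Md = left_idealD[OF Ml]
    let ?J = "{m \<oplus> r \<otimes> x | m r. m \<in> M \<and> r \<in> carrier R}"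
    have "m \<in> ?J" if "m \<in> M" for m
    proof -
      have "m = m \<oplus> \<zero> \<otimes> x" using that x Md(1) by auto
      then show ?thesis using that by blast
    qed
    moreover have "x \<in> ?J"
    proof -
      have "x = \<zero> \<oplus> \<one> \<otimes> x" using x by auto
      then show ?thesis using Md(2) by blast
    qed
    ultimately have "?J = carrier R"
      using max[of ?J] left_ideal_cyclic_sum[OF Ml] x \<open>x \<notin> M\<close> by blast
    then obtain m r where mr: "m \<in> M" "r \<in> carrier R" "\<one> = m \<oplus> r \<otimes> x"
      using one_closed by blast
    then have "\<one> \<ominus> r \<otimes> x = m"
      using x Md(1) by (auto simp: minus_eq a_assoc r_neg)
    then have "m \<in> Units R" using x mr(2) by metis
    then have "inv m \<otimes> m = \<one>" "inv m \<in> carrier R" by auto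
    then have "\<one> \<in> M" using Md(4)[of "inv m" m] mr(1) by simp
    then show False using left_ideal_eq_carrier[OF Ml] Mn by blast
  qed
  then show "x \<in> jacobson_radical R" using x by (simp add: jacobson_radical_def)
qed

text \<open>If v inverts 1 - a b, then 1 + b v a inverts 1 - b a. The formula comes from the
  geometric series: the sum of the powers of b a is 1 + b (sum of the powers of a b) a.\<close>

lemma one_minus_mult_Units:
  assumes ab: "a \<in> carrier R" "b \<in> carrier R" and u: "\<one> \<ominus> a \<otimes> b \<in> Units R"
  shows "\<one> \<ominus> b \<otimes> a \<in> Units R"
proof -
  define v where "v = inv (\<one> \<ominus> a \<otimes> b)"
  have v: "v \<in> carrier R" "(\<one> \<ominus> a \<otimes> b) \<otimes> v = \<one>" "v \<otimes> (\<one> \<ominus> a \<otimes> b) = \<one>"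
    using u by (auto simp: v_def)
  \<comment> \<open>The two defining equations of \<open>v\<close>, solved for its product with a b.
    In the expansions below they make the terms b v a cancel and leave b a to cancel against - b
    a.\<close>
  have 1: "a \<otimes> b \<otimes> v = v \<ominus> \<one>"
  proof -
    have "v \<ominus> \<one> = v \<ominus> (\<one> \<ominus> a \<otimes> b) \<otimes> v" using v by simp
    also have "\<dots> = a \<otimes> b \<otimes> v" using v(1) ab
      by (simp add: minus_eq l_distr l_minus minus_add r_neg1 a_assoc r_neg2)
    finally show ?thesis by simp
  qed
  have 2: "v \<otimes> a \<otimes> b = v \<ominus> \<one>"
  proof -
    have "v \<ominus> \<one> = v \<ominus> v \<otimes> (\<one> \<ominus> a \<otimes> b)" using v by simp
    also have "\<dots> = v \<otimes> a \<otimes> b" using v(1) ab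
      by (simp add: minus_eq r_distr r_minus minus_add r_neg1 a_assoc r_neg2 m_assoc)
    finally show ?thesis by simp
  qed
  let ?w = "\<one> \<oplus> b \<otimes> v \<otimes> a"
  have "(\<one> \<ominus> b \<otimes> a) \<otimes> ?w = \<one> \<ominus> b \<otimes> a \<oplus> (b \<otimes> v \<otimes> a \<ominus> b \<otimes> (a \<otimes> b \<otimes> v) \<otimes> a)"
    using ab v(1) by (simp add: minus_eq l_distr r_distr l_minus m_assoc a_ac minus_add)
  also have "\<dots> = \<one>"
    unfolding 1 using ab v(1)
    by (simp add: minus_eq l_distr r_distr l_minus r_minus m_assoc a_ac minus_add r_neg r_neg1 r_neg2)
  finally have r: "(\<one> \<ominus> b \<otimes> a) \<otimes> ?w = \<one>" .
  have "?w \<otimes> (\<one> \<ominus> b \<otimes> a) = \<one> \<ominus> b \<otimes> a \<oplus> (b \<otimes> v \<otimes> a \<ominus> b \<otimes> (v \<otimes> a \<otimes> b) \<otimes> a)"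
    using ab v(1) by (simp add: minus_eq l_distr r_distr l_minus r_minus m_assoc a_ac minus_add)
  also have "\<dots> = \<one>"
    unfolding 2 using ab v(1)
    by (simp add: minus_eq l_distr r_distr l_minus r_minus m_assoc a_ac minus_add r_neg r_neg1 r_neg2)
  finally show ?thesis using r ab v(1) unfolding Units_def by blast
qed

end

section \<open>Anti-isomorphisms of rings\<close>

text \<open>Only sums and products are recorded, since the radical and commutation are matters of
  the ring structure. Preservation of the unit, zero and negatives is derived from these.\<close>

definition anti_iso :: "('a, 'r) ring_scheme \<Rightarrow> ('b, 's) ring_scheme \<Rightarrow> ('a \<Rightarrow> 'b) set" where
  "anti_iso A B = {h. bij_betw h (carrier A) (carrier B) \<and>
     (\<forall>x\<in>carrier A. \<forall>y\<in>carrier A. h (x \<oplus>\<^bsub>A\<^esub> y) = h x \<oplus>\<^bsub>B\<^esub> h y \<and> h (x \<otimes>\<^bsub>A\<^esub> y) = h y \<otimes>\<^bsub>B\<^esub> h x)}"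

lemma anti_iso_inv:
  assumes "ring A" "h \<in> anti_iso A B"
  shows "inv_into (carrier A) h \<in> anti_iso B A"
proof -
  interpret A: ring A by fact
  have h: "bij_betw h (carrier A) (carrier B)"
    "\<And>x y. x \<in> carrier A \<Longrightarrow> y \<in> carrier A \<Longrightarrow> h (x \<oplus>\<^bsub>A\<^esub> y) = h x \<oplus>\<^bsub>B\<^esub> h y"
    "\<And>x y. x \<in> carrier A \<Longrightarrow> y \<in> carrier A \<Longrightarrow> h (x \<otimes>\<^bsub>A\<^esub> y) = h y \<otimes>\<^bsub>B\<^esub> h x"
    using assms(2) by (auto simp: anti_iso_def)
  then have inj: "inj_on h (carrier A)" and im: "h ` carrier A = carrier B" by (auto simp: bij_betw_def)
  have "inv_into (carrier A) h (h x \<oplus>\<^bsub>B\<^esub> h y) = x \<oplus>\<^bsub>A\<^esub> y"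
    "inv_into (carrier A) h (h x \<otimes>\<^bsub>B\<^esub> h y) = y \<otimes>\<^bsub>A\<^esub> x"
    if "x \<in> carrier A" "y \<in> carrier A" for x y
    using that h(2,3)[symmetric] inv_into_f_f[OF inj] by simp_all
  then show ?thesis
    unfolding anti_iso_def using bij_betw_inv_into[OF h(1)]
    by (auto simp: im[symmetric] inv_into_f_f[OF inj])
qed

text \<open>The map takes 1 - r x to 1 - (h x)(h r), with the factors in the wrong order for the
  left-handed criterion; \<open>one_minus_mult_Units\<close> turns them around.\<close>

lemma anti_iso_jacobson_radical:
  assumes "ring A" "ring B" "h \<in> anti_iso A B" and x: "x \<in> jacobson_radical A"
  shows "h x \<in> jacobson_radical B"
proof -
  interpret A: ring A by fact
  interpret B: ring B by fact
  have h: "bij_betw h (carrier A) (carrier B)"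
    "\<And>x y. x \<in> carrier A \<Longrightarrow> y \<in> carrier A \<Longrightarrow> h (x \<oplus>\<^bsub>A\<^esub> y) = h x \<oplus>\<^bsub>B\<^esub> h y"
    "\<And>x y. x \<in> carrier A \<Longrightarrow> y \<in> carrier A \<Longrightarrow> h (x \<otimes>\<^bsub>A\<^esub> y) = h y \<otimes>\<^bsub>B\<^esub> h x"
    using assms(3) by (auto simp: anti_iso_def)
  then have im: "h ` carrier A = carrier B" by (auto simp: bij_betw_def)
  then have hc: "\<And>x. x \<in> carrier A \<Longrightarrow> h x \<in> carrier B" by auto
  \<comment> \<open>With e a preimage of the unit of B: h e = h (e 1) = (h 1)(h e) = h 1.\<close>
  have h1: "h \<one>\<^bsub>A\<^esub> = \<one>\<^bsub>B\<^esub>"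
  proof -
    obtain e where "e \<in> carrier A" "h e = \<one>\<^bsub>B\<^esub>" using im B.one_closed by (metis imageE)
    then show ?thesis using h(3)[of e "\<one>\<^bsub>A\<^esub>"] hc[of "\<one>\<^bsub>A\<^esub>"] by simp
  qed
  have h0: "h \<zero>\<^bsub>A\<^esub> = \<zero>\<^bsub>B\<^esub>"
    using h(2)[of "\<zero>\<^bsub>A\<^esub>" "\<zero>\<^bsub>A\<^esub>"] hc[of "\<zero>\<^bsub>A\<^esub>"] by (simp add: B.add.l_cancel_one')
  have hneg: "h (\<ominus>\<^bsub>A\<^esub> y) = \<ominus>\<^bsub>B\<^esub> h y" if "y \<in> carrier A" for y
    using h(2)[of "\<ominus>\<^bsub>A\<^esub> y" y] hc that h0 by (simp add: A.l_neg B.minus_equality)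
  have hU: "h u \<in> Units B" if "u \<in> Units A" for u
  proof -
    obtain v where "v \<in> carrier A" "u \<in> carrier A" "v \<otimes>\<^bsub>A\<^esub> u = \<one>\<^bsub>A\<^esub>" "u \<otimes>\<^bsub>A\<^esub> v = \<one>\<^bsub>A\<^esub>"
      using \<open>u \<in> Units A\<close> by (auto simp: Units_def)
    then have "h u \<otimes>\<^bsub>B\<^esub> h v = \<one>\<^bsub>B\<^esub>" "h v \<otimes>\<^bsub>B\<^esub> h u = \<one>\<^bsub>B\<^esub>" "h u \<in> carrier B" "h v \<in> carrier B"
      using h(3)[symmetric] h1 hc by simp_all
    then show ?thesis by (auto simp: Units_def)
  qed
  have xc: "x \<in> carrier A" using x by (simp add: jacobson_radical_def)
  have "\<one>\<^bsub>B\<^esub> \<ominus>\<^bsub>B\<^esub> s \<otimes>\<^bsub>B\<^esub> h x \<in> Units B" if "s \<in> carrier B" for s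
  proof -
    have "s \<in> h ` carrier A" using that by (simp add: im)
    then obtain r where r: "s = h r" "r \<in> carrier A" by (rule imageE)
    then have "\<one>\<^bsub>A\<^esub> \<ominus>\<^bsub>A\<^esub> r \<otimes>\<^bsub>A\<^esub> x \<in> Units A"
      using x by (simp add: A.jacobson_radical_iff_Units)
    then have "h (\<one>\<^bsub>A\<^esub> \<ominus>\<^bsub>A\<^esub> r \<otimes>\<^bsub>A\<^esub> x) \<in> Units B" by (rule hU)
    then have "\<one>\<^bsub>B\<^esub> \<ominus>\<^bsub>B\<^esub> h x \<otimes>\<^bsub>B\<^esub> h r \<in> Units B"
      using r xc by (simp add: A.minus_eq B.minus_eq h hneg h1)
    then show ?thesis using r xc hc B.one_minus_mult_Units by simp
  qed
  then show ?thesis using xc hc by (simp add: B.jacobson_radical_iff_Units)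
qed

text \<open>Reversing both sides of x y = y x gives the same kind of equation, so commuting pairs go
  to commuting pairs. The inverse is again an anti-isomorphism, which gives the other
  inclusion.\<close>

lemma anti_iso_card_commuting:
  assumes "ring A" "ring B" "h \<in> anti_iso A B"
  shows "card {(x, y) \<in> jacobson_radical A \<times> jacobson_radical A. x \<otimes>\<^bsub>A\<^esub> y = y \<otimes>\<^bsub>A\<^esub> x} =
    card {(x, y) \<in> jacobson_radical B \<times> jacobson_radical B. x \<otimes>\<^bsub>B\<^esub> y = y \<otimes>\<^bsub>B\<^esub> x}"
    (is "card ?S = card ?T")
proof (rule bij_betw_same_card[where f = "map_prod h h"])
  let ?g = "inv_into (carrier A) h"
  note g = anti_iso_inv[OF assms(1,3)]
  have sub: "x \<in> jacobson_radical R \<Longrightarrow> x \<in> carrier R" for x and R :: "('e, 'x) ring_scheme"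
    by (simp add: jacobson_radical_def)
  have h: "bij_betw h (carrier A) (carrier B)"
    and hm: "\<And>x y. x \<in> carrier A \<Longrightarrow> y \<in> carrier A \<Longrightarrow> h (x \<otimes>\<^bsub>A\<^esub> y) = h y \<otimes>\<^bsub>B\<^esub> h x"
    using assms(3) by (auto simp: anti_iso_def)
  have gm: "\<And>x y. x \<in> carrier B \<Longrightarrow> y \<in> carrier B \<Longrightarrow> ?g (x \<otimes>\<^bsub>B\<^esub> y) = ?g y \<otimes>\<^bsub>A\<^esub> ?g x"
    using g by (auto simp: anti_iso_def)
  note hJ = anti_iso_jacobson_radical[OF assms]
    and gJ = anti_iso_jacobson_radical[OF assms(2,1) g]
  show "bij_betw (map_prod h h) ?S ?T"
  proof (rule bij_betw_byWitness[where f' = "map_prod ?g ?g"])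
    show "\<forall>a\<in>?S. map_prod ?g ?g (map_prod h h a) = a"
      using bij_betw_inv_into_left[OF h] by (auto simp: sub)
    show "\<forall>a\<in>?T. map_prod h h (map_prod ?g ?g a) = a"
      using bij_betw_inv_into_right[OF h] by (auto simp: sub)
    show "map_prod h h ` ?S \<subseteq> ?T"
      by (auto simp: hJ) (metis hm sub)
    show "map_prod ?g ?g ` ?T \<subseteq> ?S"
      by (auto simp: gJ) (metis gm sub)
  qed
qed


section \<open>Paths\<close>

text \<open>A walk that repeats a vertex contains a closed walk. So walks visit distinct vertices,
  which bounds their length, and there are finitely many lists of bounded length over the
  arcs.\<close>

lemma (in fin_digraph) finite_paths_acyclic:
  assumes "acyclic_quiver G"
  shows "finite (paths G i j)"
proof (rule finite_subset)
  show "paths G i j \<subseteq> {p. set p \<subseteq> arcs G \<and> length p \<le> card (verts G)}"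
  proof
    fix p assume "p \<in> paths G i j"
    then have p: "awalk i p j" by (simp add: paths_def)
    have "distinct (awalk_verts i p)"
    proof (rule ccontr)
      assume "\<not> distinct (awalk_verts i p)"
      then obtain q r s v where "p = q @ r @ s" "r \<noteq> []" "awalk v r v"
        using awalk_not_distinct_decomp[OF p] by blast
      then show False using assms by (auto simp: acyclic_quiver_def)
    qed
    then have "length (awalk_verts i p) = card (set (awalk_verts i p))"
      by (rule distinct_card[symmetric])
    also have "\<dots> \<le> card (verts G)"
      using p by (intro card_mono) (auto dest: awalk_verts_in_verts)
    finally show "p \<in> {p. set p \<subseteq> arcs G \<and> length p \<le> card (verts G)}"
      using p by (auto simp: length_awalk_verts awalk_def)
  qed
  show "finite {p. set p \<subseteq> arcs G \<and> length p \<le> card (verts G)}"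
    by (rule finite_lists_length_le[OF finite_arcs])
qed

context fin_digraph
begin

lemma paths_Nil: "[] \<in> paths G i j \<longleftrightarrow> i = j \<and> i \<in> verts G"
  by (simp add: paths_def awalk_Nil_iff)

lemma paths_Cons: "a # p \<in> paths G i j \<longleftrightarrow> a \<in> arcs G \<and> i = tail G a \<and> p \<in> paths G (head G a) j"
  by (simp add: paths_def awalk_Cons_iff)

text \<open>An arc list does not record where it is cut when \<open>q\<close> is empty; the second
  hypothesis then supplies j = k. Otherwise the first arc of \<open>q\<close> determines the vertex
  of the cut.\<close>

lemma paths_append_left:
  assumes "r @ q \<in> paths G i k" "q \<in> paths G j k"
  shows "r \<in> paths G i j"
proof (cases q)
  case Nil
  then show ?thesis using assms by (simp add: paths_Nil)
next
  case (Cons a q')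
  then have "r @ [a] \<in> paths G i (head G a)" if "r @ (a # q') \<in> paths G i k" for r
    using that
  proof (induction r arbitrary: i)
    case Nil
    then show ?case by (auto simp: paths_Cons paths_Nil)
  next
    case (Cons b r)
    then show ?case by (auto simp: paths_Cons)
  qed
  then show ?thesis using assms Cons by (simp add: paths_snoc paths_Cons)
qed

lemma rev_mem_paths_op_quiver: "rev p \<in> paths (op_quiver G) i j \<longleftrightarrow> p \<in> paths G j i"
proof (induction p arbitrary: j)
  case Nil
  interpret op: fin_digraph "op_quiver G" by (rule fin_digraph_op_quiver) unfold_locales
  have "verts (op_quiver G) = verts G" by (simp add: op_quiver_def)
  then show ?case by (auto simp: paths_Nil op.paths_Nil)
next
  case (Cons a p)
  then show ?case by (auto simp: paths_snoc paths_Cons op_quiver_def)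
qed

lemma mem_paths_op_quiver: "p \<in> paths (op_quiver G) i j \<longleftrightarrow> rev p \<in> paths G j i"
  using rev_mem_paths_op_quiver[of "rev p"] by simp

end


section \<open>Matrices of paths\<close>

definition summands :: "('v, 'a) pre_digraph \<Rightarrow> ('v \<Rightarrow> nat) \<Rightarrow> ('v \<times> nat) set" where
  "summands Q d = (SIGMA i:verts Q. {..<d i})"

text \<open>A matrix of combinations of paths is flattened to one scalar function on these triples,
  so the set of matrices is a plain extensional function space.\<close>

definition entries ::
  "('v, 'a) pre_digraph \<Rightarrow> ('v \<Rightarrow> nat) \<Rightarrow> (('v \<times> nat) \<times> ('v \<times> nat) \<times> 'a list) set" where
  "entries Q d = {(s, t, p). s \<in> summands Q d \<and> t \<in> summands Q d \<and> p \<in> paths Q (fst t) (fst s)}"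

text \<open>The index set of the sums in matrix multiplication over the path algebra: a cut of
  \<open>p\<close> together with a summand \<open>u\<close> at the vertex of the cut. Several
  summands may sit at the same vertex.\<close>

definition factorizations ::
  "('v, 'a) pre_digraph \<Rightarrow> ('v \<Rightarrow> nat) \<Rightarrow> 'v \<Rightarrow> 'a list \<Rightarrow> 'v \<Rightarrow> (('v \<times> nat) \<times> 'a list \<times> 'a list) set"
  where "factorizations Q d i p j =
    {(u, r, q). u \<in> summands Q d \<and> r \<in> paths Q i (fst u) \<and> q \<in> paths Q (fst u) j \<and> r @ q = p}"

definition basis ::
  "('k, 'r) ring_scheme \<Rightarrow> ('v, 'a) pre_digraph \<Rightarrow> ('v \<Rightarrow> nat) \<Rightarrow> 'v \<Rightarrow> 'v \<times> nat \<Rightarrow> 'a list \<Rightarrow>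
    'v \<times> nat \<Rightarrow> 'a list \<Rightarrow> 'k" where
  "basis K Q d j s q =
    (\<lambda>t\<in>summands Q d. \<lambda>p\<in>paths Q (fst t) j. if t = s \<and> p = q then \<one>\<^bsub>K\<^esub> else \<zero>\<^bsub>K\<^esub>)"

text \<open>
  The constant path generates the summand \<open>s\<close>, so an endomorphism is determined by the coefficients
  of the images of these generators: the entry at \<open>(s, t, p)\<close> is the coefficient of the path \<open>p\<close>,
  from \<open>fst t\<close> to \<open>fst s\<close>, in the summand \<open>t\<close>.
\<close>

definition path_matrix ::
  "('k, 'r) ring_scheme \<Rightarrow> ('v, 'a) pre_digraph \<Rightarrow> ('v \<Rightarrow> nat) \<Rightarrow>
    ('v \<Rightarrow> ('v \<times> nat \<Rightarrow> 'a list \<Rightarrow> 'k) \<Rightarrow> 'v \<times> nat \<Rightarrow> 'a list \<Rightarrow> 'k) \<Rightarrow>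
    ('v \<times> nat) \<times> ('v \<times> nat) \<times> 'a list \<Rightarrow> 'k" where
  "path_matrix K Q d f = (\<lambda>(s, t, p)\<in>entries Q d. f (fst s) (basis K Q d (fst s) s []) t p)"

text \<open>The formula is forced: with e_u the generator of summand u, x is the sum of x u q times
  e_u q, and an endomorphism f sends e_u q to f(e_u) q. The coefficient of p in summand t of f(e_u)
  q is that of r in f(e_u), where p = r q.\<close>

definition matrix_apply ::
  "('k, 'r) ring_scheme \<Rightarrow> ('v, 'a) pre_digraph \<Rightarrow> ('v \<Rightarrow> nat) \<Rightarrow>
    (('v \<times> nat) \<times> ('v \<times> nat) \<times> 'a list \<Rightarrow> 'k) \<Rightarrow> 'v \<Rightarrow>
    ('v \<times> nat \<Rightarrow> 'a list \<Rightarrow> 'k) \<Rightarrow> 'v \<times> nat \<Rightarrow> 'a list \<Rightarrow> 'k" where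
  "matrix_apply K Q d M j x = (\<lambda>t\<in>summands Q d. \<lambda>p\<in>paths Q (fst t) j.
    finsum K (\<lambda>(u, r, q). x u q \<otimes>\<^bsub>K\<^esub> M (u, t, r)) (factorizations Q d (fst t) p j))"

text \<open>A factorization is determined by the summand and the position of the cut.\<close>

lemma finite_factorizations:
  assumes "finite (verts Q)"
  shows "finite (factorizations Q d i p j)"
proof (rule finite_subset)
  show "factorizations Q d i p j \<subseteq> (\<lambda>(u, k). (u, take k p, drop k p)) ` (summands Q d \<times> {..length p})"
  proof
    fix z assume "z \<in> factorizations Q d i p j"
    then obtain u r q where "z = (u, r, q)" "u \<in> summands Q d" "r @ q = p"
      by (auto simp: factorizations_def)
    then have "z = (\<lambda>(u, k). (u, take k p, drop k p)) (u, length r)"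
      "(u, length r) \<in> summands Q d \<times> {..length p}" by auto
    then show "z \<in> (\<lambda>(u, k). (u, take k p, drop k p)) ` (summands Q d \<times> {..length p})"
      by (rule image_eqI)
  qed
  show "finite ((\<lambda>(u, k). (u, take k p, drop k p)) ` (summands Q d \<times> {..length p}))"
    using assms by (simp add: summands_def)
qed

section \<open>The sum of projectives in coordinates\<close>

text \<open>Acyclicity is used in the form of finite path sets, a property that passes to the
  opposite quiver by reversing lists. It also makes the finite-support condition of
  \<open>free_space\<close> automatic, so the spaces are full function spaces.\<close>

locale quiver_projectives = field K + Q: fin_digraph Q
  for K :: "('k, 'r) ring_scheme" (structure) and Q :: "('v, 'a) pre_digraph" +
  fixes d :: "'v \<Rightarrow> nat"
  assumes finite_paths: "finite (paths Q i j)"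
begin

abbreviation "P \<equiv> proj_rep_sum K Q d"
abbreviation "A \<equiv> End_algebra K Q P"
abbreviation "S \<equiv> summands Q d"

lemma rep_space_P:
  "carrier (rep_space P j) = (\<Pi>\<^sub>E s\<in>S. paths Q (fst s) j \<rightarrow>\<^sub>E carrier K)"
  "x \<oplus>\<^bsub>rep_space P j\<^esub> y = (\<lambda>s\<in>S. \<lambda>p\<in>paths Q (fst s) j. x s p \<oplus> y s p)"
  "c \<odot>\<^bsub>rep_space P j\<^esub> x = (\<lambda>s\<in>S. \<lambda>p\<in>paths Q (fst s) j. c \<otimes> x s p)"
  "\<zero>\<^bsub>rep_space P j\<^esub> = (\<lambda>s\<in>S. \<lambda>p\<in>paths Q (fst s) j. \<zero>)"
  by (simp_all add: proj_rep_sum_def direct_sum_rep_def proj_rep_def free_space_def summands_def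
      case_prod_unfold finite_paths)

lemma rep_map_P:
  "rep_map P a x = (\<lambda>s\<in>S. \<lambda>q\<in>paths Q (fst s) (head Q a). if \<exists>c. q = c @ [a] then x s (butlast q) else \<zero>)"
  by (simp add: proj_rep_sum_def direct_sum_rep_def proj_rep_def summands_def case_prod_unfold)

lemma rep_space_P_ext:
  assumes "x \<in> carrier (rep_space P j)" "y \<in> carrier (rep_space P j)"
    and "\<And>s p. s \<in> S \<Longrightarrow> p \<in> paths Q (fst s) j \<Longrightarrow> x s p = y s p"
  shows "x = y"
proof (rule PiE_ext)
  show xy: "x \<in> (\<Pi>\<^sub>E s\<in>S. paths Q (fst s) j \<rightarrow>\<^sub>E carrier K)"
    "y \<in> (\<Pi>\<^sub>E s\<in>S. paths Q (fst s) j \<rightarrow>\<^sub>E carrier K)"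
    using assms(1,2) by (simp_all add: rep_space_P)
  show "x s = y s" if "s \<in> S" for s
    using xy that assms(3) by (intro PiE_ext[of "x s" "paths Q (fst s) j" "\<lambda>_. carrier K"]) auto
qed

lemma rep_space_P_closed:
  "x \<in> carrier (rep_space P j) \<Longrightarrow> s \<in> S \<Longrightarrow> p \<in> paths Q (fst s) j \<Longrightarrow> x s p \<in> carrier K"
  by (auto simp: rep_space_P PiE_iff)

lemma rep_space_P_mem:
  "(\<And>s p. s \<in> S \<Longrightarrow> p \<in> paths Q (fst s) j \<Longrightarrow> h s p \<in> carrier K) \<Longrightarrow>
    (\<lambda>s\<in>S. \<lambda>p\<in>paths Q (fst s) j. h s p) \<in> carrier (rep_space P j)"
  by (auto simp: rep_space_P)

lemma basis_mem: "basis K Q d j s q \<in> carrier (rep_space P j)"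
  unfolding basis_def by (rule rep_space_P_mem) simp

lemma ring_A: "ring A"
  by (rule quiver_representation.End_algebra_ring[OF quiver_representation_proj_sum[OF field_axioms
          Q.fin_digraph_axioms]])

lemma A_closed: "f \<in> carrier A \<Longrightarrow> j \<in> verts Q \<Longrightarrow> x \<in> carrier (rep_space P j) \<Longrightarrow> f j x \<in> carrier (rep_space P j)"
  by (auto simp: End_algebra_def rep_hom_def linear_maps_def PiE_iff image_subset_iff)

lemma A_add:
  "f \<in> carrier A \<Longrightarrow> j \<in> verts Q \<Longrightarrow> x \<in> carrier (rep_space P j) \<Longrightarrow> y \<in> carrier (rep_space P j) \<Longrightarrow>
    f j (x \<oplus>\<^bsub>rep_space P j\<^esub> y) = f j x \<oplus>\<^bsub>rep_space P j\<^esub> f j y"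
  by (auto simp: End_algebra_def rep_hom_def linear_maps_def PiE_iff)

lemma A_smult:
  "f \<in> carrier A \<Longrightarrow> j \<in> verts Q \<Longrightarrow> c \<in> carrier K \<Longrightarrow> x \<in> carrier (rep_space P j) \<Longrightarrow>
    f j (c \<odot>\<^bsub>rep_space P j\<^esub> x) = c \<odot>\<^bsub>rep_space P j\<^esub> f j x"
  by (auto simp: End_algebra_def rep_hom_def linear_maps_def PiE_iff)

lemma A_rep_map:
  "f \<in> carrier A \<Longrightarrow> a \<in> arcs Q \<Longrightarrow> x \<in> carrier (rep_space P (tail Q a)) \<Longrightarrow>
    f (head Q a) (rep_map P a x) = rep_map P a (f (tail Q a) x)"
  by (auto simp: End_algebra_def rep_hom_def)

lemma A_ext:
  assumes "f \<in> carrier A" "g \<in> carrier A"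
    and eq: "\<And>j x. j \<in> verts Q \<Longrightarrow> x \<in> carrier (rep_space P j) \<Longrightarrow> f j x = g j x"
  shows "f = g"
proof (rule PiE_ext)
  show fg: "f \<in> (\<Pi>\<^sub>E j\<in>verts Q. extensional (carrier (rep_space P j)))"
    "g \<in> (\<Pi>\<^sub>E j\<in>verts Q. extensional (carrier (rep_space P j)))"
    using assms(1,2) by (auto simp: End_algebra_def rep_hom_def PiE_def)
  show "f j = g j" if "j \<in> verts Q" for j
    using fg that eq by (intro extensionalityI[of _ "carrier (rep_space P j)"]) auto
qed

lemma path_matrix_mem:
  assumes "f \<in> carrier A"
  shows "path_matrix K Q d f \<in> entries Q d \<rightarrow>\<^sub>E carrier K"
proof -
  have "f (fst s) (basis K Q d (fst s) s []) t p \<in> carrier K" if "(s, t, p) \<in> entries Q d" for s t p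
  proof -
    from that have "s \<in> S" "t \<in> S" "p \<in> paths Q (fst t) (fst s)" by (simp_all add: entries_def)
    moreover have "fst s \<in> verts Q" using \<open>s \<in> S\<close> by (auto simp: summands_def)
    ultimately show ?thesis using rep_space_P_closed[OF A_closed[OF assms _ basis_mem]] by blast
  qed
  then show ?thesis by (auto simp: path_matrix_def)
qed

section \<open>The endomorphism given by a matrix\<close>

context
  fixes M assumes M: "M \<in> entries Q d \<rightarrow>\<^sub>E carrier K"
begin

lemma matrix_closed: "s \<in> S \<Longrightarrow> t \<in> S \<Longrightarrow> p \<in> paths Q (fst t) (fst s) \<Longrightarrow> M (s, t, p) \<in> carrier K"
  by (intro PiE_mem[OF M]) (simp add: entries_def)

lemma apply_term_closed:
  assumes "x \<in> carrier (rep_space P j)" "t \<in> S"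
  shows "(\<lambda>(u, r, q). x u q \<otimes> M (u, t, r)) \<in> factorizations Q d (fst t) p j \<rightarrow> carrier K"
proof (rule Pi_I)
  fix z assume "z \<in> factorizations Q d (fst t) p j"
  then obtain u r q where "z = (u, r, q)" "u \<in> S" "r \<in> paths Q (fst t) (fst u)" "q \<in> paths Q (fst u) j"
    by (auto simp: factorizations_def)
  then show "(case z of (u, r, q) \<Rightarrow> x u q \<otimes> M (u, t, r)) \<in> carrier K"
    using assms matrix_closed rep_space_P_closed[OF assms(1)] by simp
qed

lemma matrix_apply_closed:
  assumes "x \<in> carrier (rep_space P j)"
  shows "matrix_apply K Q d M j x \<in> carrier (rep_space P j)"
  unfolding matrix_apply_def
  by (intro rep_space_P_mem finsum_closed apply_term_closed[OF assms])

lemma matrix_apply_add: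
  assumes x: "x \<in> carrier (rep_space P j)" and y: "y \<in> carrier (rep_space P j)"
  shows "matrix_apply K Q d M j (x \<oplus>\<^bsub>rep_space P j\<^esub> y) =
    matrix_apply K Q d M j x \<oplus>\<^bsub>rep_space P j\<^esub> matrix_apply K Q d M j y"
proof -
  have "finsum K (\<lambda>(u, r, q). (x \<oplus>\<^bsub>rep_space P j\<^esub> y) u q \<otimes> M (u, t, r)) (factorizations Q d (fst t) p j) =
     finsum K (\<lambda>(u, r, q). x u q \<otimes> M (u, t, r)) (factorizations Q d (fst t) p j) \<oplus>
     finsum K (\<lambda>(u, r, q). y u q \<otimes> M (u, t, r)) (factorizations Q d (fst t) p j)"
    if t: "t \<in> S" for t p
  proof (subst finsum_addf[symmetric, OF apply_term_closed[OF x t] apply_term_closed[OF y t]],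
      rule finsum_cong'[OF refl])
    show "(\<lambda>z. (case z of (u, r, q) \<Rightarrow> x u q \<otimes> M (u, t, r)) \<oplus> (case z of (u, r, q) \<Rightarrow> y u q \<otimes> M (u, t, r)))
      \<in> factorizations Q d (fst t) p j \<rightarrow> carrier K"
      using apply_term_closed[OF x t, of p] apply_term_closed[OF y t, of p] by (auto simp: Pi_iff)
  next
    fix z assume "z \<in> factorizations Q d (fst t) p j"
    then obtain u r q where "z = (u, r, q)" "u \<in> S" "r \<in> paths Q (fst t) (fst u)" "q \<in> paths Q (fst u) j"
      by (auto simp: factorizations_def)
    then show "(case z of (u, r, q) \<Rightarrow> (x \<oplus>\<^bsub>rep_space P j\<^esub> y) u q \<otimes> M (u, t, r)) =
       (case z of (u, r, q) \<Rightarrow> x u q \<otimes> M (u, t, r)) \<oplus> (case z of (u, r, q) \<Rightarrow> y u q \<otimes> M (u, t, r))"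
      using t matrix_closed rep_space_P_closed[OF x] rep_space_P_closed[OF y]
      by (simp add: rep_space_P l_distr)
  qed
  then show ?thesis
    by (simp add: matrix_apply_def rep_space_P(2)[of j "restrict _ _"] cong: restrict_cong)
qed

lemma matrix_apply_smult:
  assumes c: "c \<in> carrier K" and x: "x \<in> carrier (rep_space P j)"
  shows "matrix_apply K Q d M j (c \<odot>\<^bsub>rep_space P j\<^esub> x) = c \<odot>\<^bsub>rep_space P j\<^esub> matrix_apply K Q d M j x"
proof -
  have "finsum K (\<lambda>(u, r, q). (c \<odot>\<^bsub>rep_space P j\<^esub> x) u q \<otimes> M (u, t, r)) (factorizations Q d (fst t) p j) =
     c \<otimes> finsum K (\<lambda>(u, r, q). x u q \<otimes> M (u, t, r)) (factorizations Q d (fst t) p j)"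
    if t: "t \<in> S" for t p
  proof (subst finsum_rdistr[OF finite_factorizations[OF Q.finite_verts] c apply_term_closed[OF x t]],
      rule finsum_cong'[OF refl])
    show "(\<lambda>z. c \<otimes> (case z of (u, r, q) \<Rightarrow> x u q \<otimes> M (u, t, r)))
      \<in> factorizations Q d (fst t) p j \<rightarrow> carrier K"
      using apply_term_closed[OF x t, of p] c by (auto simp: Pi_iff)
  next
    fix z assume "z \<in> factorizations Q d (fst t) p j"
    then obtain u r q where "z = (u, r, q)" "u \<in> S" "r \<in> paths Q (fst t) (fst u)" "q \<in> paths Q (fst u) j"
      by (auto simp: factorizations_def)
    then show "(case z of (u, r, q) \<Rightarrow> (c \<odot>\<^bsub>rep_space P j\<^esub> x) u q \<otimes> M (u, t, r)) =
       c \<otimes> (case z of (u, r, q) \<Rightarrow> x u q \<otimes> M (u, t, r))"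
      using t c matrix_closed rep_space_P_closed[OF x]
      by (simp add: rep_space_P m_assoc)
  qed
  then show ?thesis
    by (simp add: matrix_apply_def rep_space_P(3)[of j _ "restrict _ _"] cong: restrict_cong)
qed

text \<open>The matrix prepends paths on the left while an arrow appends on the right, so the two
  actions commute. Concretely, cuts of c a with a nonempty right piece match the cuts of c; the cut
  with empty right piece contributes zero, because nothing in the image of the arrow has a constant
  path.\<close>

lemma matrix_apply_rep_map:
  assumes a: "a \<in> arcs Q" and x: "x \<in> carrier (rep_space P (tail Q a))"
  shows "matrix_apply K Q d M (head Q a) (rep_map P a x) = rep_map P a (matrix_apply K Q d M (tail Q a) x)"
proof -
  have y: "rep_map P a x \<in> carrier (rep_space P (head Q a))"
    unfolding rep_map_P using rep_space_P_closed[OF x]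
    by (intro rep_space_P_mem) (auto simp: paths_snoc)
  have "finsum K (\<lambda>(u, r, q). rep_map P a x u q \<otimes> M (u, t, r)) (factorizations Q d (fst t) p (head Q a)) =
     (if \<exists>c. p = c @ [a] then
        finsum K (\<lambda>(u, r, q). x u q \<otimes> M (u, t, r)) (factorizations Q d (fst t) (butlast p) (tail Q a)) else \<zero>)"
    if t: "t \<in> S" and p: "p \<in> paths Q (fst t) (head Q a)" for t p
  proof (cases "\<exists>c. p = c @ [a]")
    case True
    then obtain c where c: "p = c @ [a]" by blast
    let ?h = "\<lambda>(u, r, q). (u, r, q @ [a])"
    let ?F = "factorizations Q d (fst t) c (tail Q a)"
    have sub: "?h ` ?F \<subseteq> factorizations Q d (fst t) p (head Q a)"
      using a by (auto simp: factorizations_def c paths_snoc)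
    have "finsum K (\<lambda>(u, r, q). rep_map P a x u q \<otimes> M (u, t, r)) (factorizations Q d (fst t) p (head Q a)) =
      finsum K (\<lambda>(u, r, q). rep_map P a x u q \<otimes> M (u, t, r)) (?h ` ?F)"
    proof (rule add.finprod_mono_neutral_cong_left[symmetric, OF finite_factorizations[OF Q.finite_verts] sub
          _ refl apply_term_closed[OF y t]])
      fix z assume z: "z \<in> factorizations Q d (fst t) p (head Q a) - ?h ` ?F"
      then obtain u r q where u: "z = (u, r, q)" "u \<in> S" "r \<in> paths Q (fst t) (fst u)"
        "q \<in> paths Q (fst u) (head Q a)" "r @ q = p"
        by (auto simp: factorizations_def)
      have "q \<noteq> c' @ [a]" for c'
      proof
        assume q: "q = c' @ [a]"
        then have "(u, r, c') \<in> ?F" using u c by (auto simp: factorizations_def paths_snoc)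
        then show False using z u(1) q by force
      qed
      then have "rep_map P a x u q = \<zero>" using u by (simp add: rep_map_P)
      then show "(case z of (u, r, q) \<Rightarrow> rep_map P a x u q \<otimes> M (u, t, r)) = \<zero>"
        using u t matrix_closed by simp
    qed
    also have "\<dots> = (\<Oplus>z\<in>?F. case ?h z of (u, r, q) \<Rightarrow> rep_map P a x u q \<otimes> M (u, t, r))"
    proof (rule finsum_reindex)
      show "(\<lambda>(u, r, q). rep_map P a x u q \<otimes> M (u, t, r)) \<in> ?h ` ?F \<rightarrow> carrier K"
        using apply_term_closed[OF y t, of p] sub by blast
      show "inj_on ?h ?F" by (auto simp: inj_on_def)
    qed
    also have "\<dots> = finsum K (\<lambda>(u, r, q). x u q \<otimes> M (u, t, r)) ?F"
    proof (rule finsum_cong'[OF refl apply_term_closed[OF x t]])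
      fix z assume "z \<in> ?F"
      then obtain u r q where "z = (u, r, q)" "u \<in> S" "q \<in> paths Q (fst u) (tail Q a)"
        by (auto simp: factorizations_def)
      then show "(case ?h z of (u, r, q) \<Rightarrow> rep_map P a x u q \<otimes> M (u, t, r)) =
        (case z of (u, r, q) \<Rightarrow> x u q \<otimes> M (u, t, r))"
        using a by (simp add: rep_map_P paths_snoc)
    qed
    finally show ?thesis by (simp add: c)
  next
    \<comment> \<open>A suffix of \<open>p\<close> that ended in \<open>a\<close> would make
      \<open>p\<close> end in \<open>a\<close>, so every coefficient of the image of
      \<open>x\<close> occurring in the sum is zero.\<close>
    case False
    have "(case z of (u, r, q) \<Rightarrow> rep_map P a x u q \<otimes> M (u, t, r)) = \<zero>"
      if "z \<in> factorizations Q d (fst t) p (head Q a)" for z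
    proof -
      from that obtain u r q where u: "z = (u, r, q)" "u \<in> S" "r \<in> paths Q (fst t) (fst u)"
        "q \<in> paths Q (fst u) (head Q a)" "r @ q = p"
        by (auto simp: factorizations_def)
      then have "rep_map P a x u q = \<zero>" using False by (auto simp: rep_map_P)
      then show ?thesis using u t matrix_closed by simp
    qed
    then show ?thesis using False by (simp add: add.finprod_one_eqI)
  qed
  then show ?thesis
    unfolding matrix_apply_def rep_map_P[of a "restrict _ _"]
    by (auto simp: fun_eq_iff paths_snoc restrict_def)
qed

text \<open>Of all factorizations only the one through \<open>s\<close> with right piece
  \<open>q\<close> meets a nonzero coefficient. The \<open>take\<close> expression is its left piece
  r, written without naming it.\<close>

lemma matrix_apply_basis:
  assumes q: "s \<in> S" "q \<in> paths Q (fst s) j" and t: "t \<in> S" "p \<in> paths Q (fst t) j"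
  shows "matrix_apply K Q d M j (basis K Q d j s q) t p =
    (if \<exists>r. p = r @ q then M (s, t, take (length p - length q) p) else \<zero>)"
proof (cases "\<exists>r. p = r @ q")
  case True
  then obtain r where r: "p = r @ q" by blast
  let ?F = "factorizations Q d (fst t) p j"
  have rp: "r \<in> paths Q (fst t) (fst s)" using Q.paths_append_left q(2) t(2) r by blast
  then have mem: "(s, r, q) \<in> ?F" using q r by (simp add: factorizations_def)
  have "finsum K (\<lambda>(u, r', q'). basis K Q d j s q u q' \<otimes> M (u, t, r')) {(s, r, q)} =
    finsum K (\<lambda>(u, r', q'). basis K Q d j s q u q' \<otimes> M (u, t, r')) ?F"
  proof (rule add.finprod_mono_neutral_cong_left[OF finite_factorizations[OF Q.finite_verts] _
          _ refl apply_term_closed[OF basis_mem t(1)]])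
    show "{(s, r, q)} \<subseteq> ?F" using mem by simp
    fix z assume z: "z \<in> ?F - {(s, r, q)}"
    then obtain u r' q' where u: "z = (u, r', q')" "u \<in> S" "r' \<in> paths Q (fst t) (fst u)"
        "q' \<in> paths Q (fst u) j" "r' @ q' = p" "\<not> (u = s \<and> q' = q)"
      using r by (auto simp: factorizations_def)
    then show "(case z of (u, r', q') \<Rightarrow> basis K Q d j s q u q' \<otimes> M (u, t, r')) = \<zero>"
      using matrix_closed t by (auto simp: basis_def)
  qed
  then show ?thesis
    using r t q rp matrix_closed by (simp add: matrix_apply_def basis_def)
next
  case False
  have "(case z of (u, r, q') \<Rightarrow> basis K Q d j s q u q' \<otimes> M (u, t, r)) = \<zero>"
    if "z \<in> factorizations Q d (fst t) p j" for z
  proof -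
    from that obtain u r q' where u: "z = (u, r, q')" "u \<in> S" "r \<in> paths Q (fst t) (fst u)"
        "q' \<in> paths Q (fst u) j" "r @ q' = p"
      by (auto simp: factorizations_def)
    then have "basis K Q d j s q u q' = \<zero>" using False by (auto simp: basis_def)
    then show ?thesis using u t matrix_closed by simp
  qed
  then show ?thesis using False t by (simp add: matrix_apply_def add.finprod_one_eqI)
qed

lemma matrix_endomorphism:
  "(\<lambda>j\<in>verts Q. \<lambda>x\<in>carrier (rep_space P j). matrix_apply K Q d M j x) \<in> carrier A"
proof -
  have "rep_map P a x \<in> carrier (rep_space P (head Q a))"
    if "x \<in> carrier (rep_space P (tail Q a))" for a x
    unfolding rep_map_P using rep_space_P_closed[OF that]
    by (intro rep_space_P_mem) (auto simp: paths_snoc)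
  moreover have "x \<oplus>\<^bsub>rep_space P j\<^esub> y \<in> carrier (rep_space P j)"
    if "x \<in> carrier (rep_space P j)" "y \<in> carrier (rep_space P j)" for j x y
    unfolding rep_space_P(2) using that by (intro rep_space_P_mem) (simp add: rep_space_P_closed)
  moreover have "c \<odot>\<^bsub>rep_space P j\<^esub> x \<in> carrier (rep_space P j)"
    if "c \<in> carrier K" "x \<in> carrier (rep_space P j)" for c j x
    unfolding rep_space_P(3) using that by (intro rep_space_P_mem) (simp add: rep_space_P_closed)
  ultimately show ?thesis
    using matrix_apply_closed matrix_apply_add matrix_apply_smult matrix_apply_rep_map
    by (simp add: End_algebra_def rep_hom_def linear_maps_def image_subset_iff)
qed

lemma path_matrix_matrix_apply:
  "path_matrix K Q d (\<lambda>j\<in>verts Q. \<lambda>x\<in>carrier (rep_space P j). matrix_apply K Q d M j x) = M"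
  (is "path_matrix K Q d ?f = M")
proof (rule PiE_ext[OF path_matrix_mem[OF matrix_endomorphism] M])
  fix z assume z: "z \<in> entries Q d"
  then obtain s t p where stp: "z = (s, t, p)" "s \<in> S" "t \<in> S" "p \<in> paths Q (fst t) (fst s)"
    by (auto simp: entries_def)
  have "fst s \<in> verts Q" using stp(2) by (auto simp: summands_def)
  then show "path_matrix K Q d ?f z = M z"
    using z stp matrix_apply_basis[of s "[]" "fst s" t p]
    by (simp add: path_matrix_def basis_mem Q.paths_Nil)
qed

end

section \<open>Every endomorphism comes from its matrix\<close>

text \<open>The basis vector of a path arises from the generator by applying its arrows one after
  another, and \<open>f\<close> commutes with each of them. Arrows append on the right, hence the
  induction from the right end. The right-hand side is the one in \<open>matrix_apply_basis\<close>,
  so that both can be compared.\<close>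

lemma endomorphism_basis:
  assumes f: "f \<in> carrier A" and s: "s \<in> S" and q: "q \<in> paths Q (fst s) j"
    and t: "t \<in> S" and p: "p \<in> paths Q (fst t) j"
  shows "f j (basis K Q d j s q) t p =
    (if \<exists>r. p = r @ q then path_matrix K Q d f (s, t, take (length p - length q) p) else \<zero>)"
  using q p
proof (induction q arbitrary: j p rule: rev_induct)
  case Nil
  then show ?case using s t by (auto simp: path_matrix_def entries_def Q.paths_Nil)
next
  case (snoc a q)
  then have a: "a \<in> arcs Q" "head Q a = j" "q \<in> paths Q (fst s) (tail Q a)"
    by (simp_all add: paths_snoc)
  have "basis K Q d j s (q @ [a]) = rep_map P a (basis K Q d (tail Q a) s q)"
    using a by (auto simp: basis_def rep_map_P fun_eq_iff paths_snoc restrict_def)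
  then have "f j (basis K Q d j s (q @ [a])) t p = rep_map P a (f (tail Q a) (basis K Q d (tail Q a) s q)) t p"
    using A_rep_map[OF f a(1) basis_mem] a(2) by simp
  also have "\<dots> = (if \<exists>c. p = c @ [a] then f (tail Q a) (basis K Q d (tail Q a) s q) t (butlast p) else \<zero>)"
    using t snoc.prems a(2) by (simp add: rep_map_P)
  also have "\<dots> = (if \<exists>r. p = r @ (q @ [a]) then path_matrix K Q d f (s, t, take (length p - length (q @ [a])) p) else \<zero>)"
  proof (cases "\<exists>c. p = c @ [a]")
    case True
    then obtain c where c: "p = c @ [a]" by blast
    then have "c \<in> paths Q (fst t) (tail Q a)" using snoc.prems by (simp add: paths_snoc)
    from snoc.IH[OF a(3) this] c show ?thesis by simp
  next
    case False
    then have "\<nexists>r. p = r @ (q @ [a])" by (metis append_assoc)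
    with False show ?thesis by (simp del: append_assoc)
  qed
  finally show ?case .
qed

text \<open>Peels off a single coefficient; this is the step of the induction on the support in the
  next lemma.\<close>

lemma rep_space_P_decompose:
  assumes x: "x \<in> carrier (rep_space P j)" and s: "s \<in> S" and q: "q \<in> paths Q (fst s) j"
  defines "x' \<equiv> \<lambda>t\<in>S. \<lambda>p\<in>paths Q (fst t) j. if t = s \<and> p = q then \<zero> else x t p"
  shows "x' \<in> carrier (rep_space P j)"
    and "x = x' \<oplus>\<^bsub>rep_space P j\<^esub> (x s q \<odot>\<^bsub>rep_space P j\<^esub> basis K Q d j s q)"
proof -
  show x': "x' \<in> carrier (rep_space P j)"
    unfolding x'_def by (rule rep_space_P_mem) (simp add: rep_space_P_closed[OF x])
  have c: "x s q \<in> carrier K" by (rule rep_space_P_closed[OF x s q])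
  show "x = x' \<oplus>\<^bsub>rep_space P j\<^esub> (x s q \<odot>\<^bsub>rep_space P j\<^esub> basis K Q d j s q)"
  proof (rule rep_space_P_ext[OF x])
    show "x' \<oplus>\<^bsub>rep_space P j\<^esub> (x s q \<odot>\<^bsub>rep_space P j\<^esub> basis K Q d j s q) \<in> carrier (rep_space P j)"
      unfolding rep_space_P(2,3) using x' c
      by (intro rep_space_P_mem) (simp add: rep_space_P_closed rep_space_P_closed[OF basis_mem])
    show "x t p = (x' \<oplus>\<^bsub>rep_space P j\<^esub> (x s q \<odot>\<^bsub>rep_space P j\<^esub> basis K Q d j s q)) t p"
      if "t \<in> S" "p \<in> paths Q (fst t) j" for t p
      using that c rep_space_P_closed[OF x] by (auto simp: rep_space_P x'_def basis_def)
  qed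
qed

text \<open>Both sides are linear and agree on basis vectors. The induction runs over a finite set
  \<open>T\<close> containing the support of x; in the end \<open>T\<close> is the set of all
  coordinates.\<close>

lemma endomorphism_eq_matrix_apply:
  assumes f: "f \<in> carrier A" and j: "j \<in> verts Q" and x: "x \<in> carrier (rep_space P j)"
  shows "f j x = matrix_apply K Q d (path_matrix K Q d f) j x"
proof -
  note M = path_matrix_mem[OF f]
  let ?F = "matrix_apply K Q d (path_matrix K Q d f) j"
  have basis: "f j (basis K Q d j s q) = ?F (basis K Q d j s q)" if "s \<in> S" "q \<in> paths Q (fst s) j" for s q
    using that endomorphism_basis[OF f] matrix_apply_basis[OF M]
    by (intro rep_space_P_ext[OF A_closed[OF f j basis_mem] matrix_apply_closed[OF M basis_mem]]) simp
  have "f j x = ?F x"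
    if "finite T" "x \<in> carrier (rep_space P j)"
      "\<And>s q. s \<in> S \<Longrightarrow> q \<in> paths Q (fst s) j \<Longrightarrow> (s, q) \<notin> T \<Longrightarrow> x s q = \<zero>" for T x
    using that
  proof (induction T arbitrary: x rule: finite_induct)
    case empty
    \<comment> \<open>Writing the zero vector as a scalar multiple by zero lets homogeneity show
      that both maps kill it.\<close>
    then have x0: "x = \<zero> \<odot>\<^bsub>rep_space P j\<^esub> x"
      using rep_space_P_mem[of j "\<lambda>_ _. \<zero>"]
      by (intro rep_space_P_ext[OF empty(1)]) (simp_all add: rep_space_P cong: restrict_cong)
    have "f j x = \<zero> \<odot>\<^bsub>rep_space P j\<^esub> f j x"
      by (subst x0) (rule A_smult[OF f j zero_closed empty(1)])
    moreover have "?F x = \<zero> \<odot>\<^bsub>rep_space P j\<^esub> ?F x"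
      by (subst x0) (rule matrix_apply_smult[OF M zero_closed empty(1)])
    moreover have "\<zero> \<odot>\<^bsub>rep_space P j\<^esub> f j x = \<zero> \<odot>\<^bsub>rep_space P j\<^esub> ?F x"
      using rep_space_P_closed[OF A_closed[OF f j empty(1)]]
        rep_space_P_closed[OF matrix_apply_closed[OF M empty(1)]]
      by (simp add: rep_space_P cong: restrict_cong)
    ultimately show ?case by simp
  next
    case (insert sq T)
    obtain s q where sq: "sq = (s, q)" by (cases sq)
    show ?case
    proof (cases "s \<in> S \<and> q \<in> paths Q (fst s) j")
      case True
      then have s: "s \<in> S" and q: "q \<in> paths Q (fst s) j" by auto
      let ?x' = "\<lambda>t\<in>S. \<lambda>p\<in>paths Q (fst t) j. if t = s \<and> p = q then \<zero> else x t p"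
      let ?b = "basis K Q d j s q"
      note x' = rep_space_P_decompose[OF insert.prems(1) s q]
      have c: "x s q \<in> carrier K" by (rule rep_space_P_closed[OF insert.prems(1) s q])
      have cb: "x s q \<odot>\<^bsub>rep_space P j\<^esub> ?b \<in> carrier (rep_space P j)"
        unfolding rep_space_P(3) using c
        by (intro rep_space_P_mem) (simp add: rep_space_P_closed[OF basis_mem])
      have IH: "f j ?x' = ?F ?x'"
        using insert.prems(2) sq by (intro insert.IH x'(1)) auto
      have "f j x = f j ?x' \<oplus>\<^bsub>rep_space P j\<^esub> (x s q \<odot>\<^bsub>rep_space P j\<^esub> f j ?b)"
        by (subst x'(2)) (simp only: A_add[OF f j x'(1) cb] A_smult[OF f j c basis_mem])
      moreover have "?F x = ?F ?x' \<oplus>\<^bsub>rep_space P j\<^esub> (x s q \<odot>\<^bsub>rep_space P j\<^esub> ?F ?b)"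
        by (subst x'(2)) (simp only: matrix_apply_add[OF M x'(1) cb] matrix_apply_smult[OF M c basis_mem])
      ultimately show ?thesis by (simp only: IH basis[OF s q])
    next
      \<comment> \<open>The new pair is not a coordinate, so \<open>T\<close> alone already covers
        the support.\<close>
      case False
      with insert sq show ?thesis by (intro insert.IH) auto
    qed
  qed
  from this[of "SIGMA s:S. paths Q (fst s) j"] x show ?thesis
    by (simp add: finite_paths summands_def)
qed

lemma bij_betw_path_matrix: "bij_betw (path_matrix K Q d) (carrier A) (entries Q d \<rightarrow>\<^sub>E carrier K)"
proof (rule bij_betwI')
  show "path_matrix K Q d f = path_matrix K Q d g \<longleftrightarrow> f = g" if "f \<in> carrier A" "g \<in> carrier A" for f g
  proof
    assume "path_matrix K Q d f = path_matrix K Q d g"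
    then show "f = g"
      by (intro A_ext[OF that])
        (simp only: endomorphism_eq_matrix_apply[OF that(1)] endomorphism_eq_matrix_apply[OF that(2)])
  qed simp
  show "\<exists>f\<in>carrier A. M = path_matrix K Q d f" if "M \<in> entries Q d \<rightarrow>\<^sub>E carrier K" for M
    by (rule bexI[where x = "\<lambda>j\<in>verts Q. \<lambda>x\<in>carrier (rep_space P j). matrix_apply K Q d M j x"])
      (rule path_matrix_matrix_apply[OF that, symmetric], rule matrix_endomorphism[OF that])
qed (rule path_matrix_mem)

lemma path_matrix_add:
  assumes "(s, t, p) \<in> entries Q d" and f: "f \<in> carrier A" and g: "g \<in> carrier A"
  shows "path_matrix K Q d (f \<oplus>\<^bsub>A\<^esub> g) (s, t, p) = path_matrix K Q d f (s, t, p) \<oplus> path_matrix K Q d g (s, t, p)"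
proof -
  have "fst s \<in> verts Q" "t \<in> S" "p \<in> paths Q (fst t) (fst s)"
    using assms(1) by (auto simp: entries_def summands_def)
  then show ?thesis
    using assms(1) by (simp add: path_matrix_def End_algebra_def basis_mem rep_space_P(2))
qed

text \<open>Composition applies \<open>g\<close> first: g sends the generator of \<open>s\<close> to
  coefficients at (u, q), and f then spreads these over the summands t by prepending r. So the right
  piece of \<open>p\<close> belongs to \<open>g\<close> and the left piece to
  \<open>f\<close>.\<close>

lemma path_matrix_mult:
  assumes stp: "(s, t, p) \<in> entries Q d" and f: "f \<in> carrier A" and g: "g \<in> carrier A"
  shows "path_matrix K Q d (f \<otimes>\<^bsub>A\<^esub> g) (s, t, p) =
    finsum K (\<lambda>(u, r, q). path_matrix K Q d g (s, u, q) \<otimes> path_matrix K Q d f (u, t, r)) (factorizations Q d (fst t) p (fst s))"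
proof -
  have s: "fst s \<in> verts Q" "s \<in> S" "t \<in> S" "p \<in> paths Q (fst t) (fst s)"
    using stp by (auto simp: entries_def summands_def)
  let ?b = "basis K Q d (fst s) s []"
  note gb = A_closed[OF g s(1) basis_mem]
  have "path_matrix K Q d (f \<otimes>\<^bsub>A\<^esub> g) (s, t, p) = f (fst s) (g (fst s) ?b) t p"
    using stp s(1) by (simp add: path_matrix_def End_algebra_def basis_mem compose_def)
  also have "\<dots> = finsum K (\<lambda>(u, r, q). g (fst s) ?b u q \<otimes> path_matrix K Q d f (u, t, r)) (factorizations Q d (fst t) p (fst s))"
    using s by (simp add: endomorphism_eq_matrix_apply[OF f s(1) gb] matrix_apply_def)
  also have "\<dots> = finsum K (\<lambda>(u, r, q). path_matrix K Q d g (s, u, q) \<otimes> path_matrix K Q d f (u, t, r)) (factorizations Q d (fst t) p (fst s))"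
  proof (rule finsum_cong'[OF refl])
    show eq: "(case z of (u, r, q) \<Rightarrow> g (fst s) ?b u q \<otimes> path_matrix K Q d f (u, t, r)) =
      (case z of (u, r, q) \<Rightarrow> path_matrix K Q d g (s, u, q) \<otimes> path_matrix K Q d f (u, t, r))"
      if "z \<in> factorizations Q d (fst t) p (fst s)" for z
      using that s by (auto simp: factorizations_def path_matrix_def entries_def)
    show "(\<lambda>(u, r, q). path_matrix K Q d g (s, u, q) \<otimes> path_matrix K Q d f (u, t, r))
      \<in> factorizations Q d (fst t) p (fst s) \<rightarrow> carrier K"
    proof (rule Pi_I)
      fix z assume z: "z \<in> factorizations Q d (fst t) p (fst s)"
      show "(case z of (u, r, q) \<Rightarrow> path_matrix K Q d g (s, u, q) \<otimes> path_matrix K Q d f (u, t, r)) \<in> carrier K"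
        unfolding eq[OF z, symmetric]
        by (rule funcset_mem[OF apply_term_closed[OF path_matrix_mem[OF f] gb s(3)] z])
    qed
  qed
  finally show ?thesis .
qed

end

section \<open>The opposite quiver\<close>

text \<open>A path p from t to s in the opposite quiver is, read backwards, a path from s to t in Q,
  which is what the entry at (t, s) collects.\<close>

definition transpose_matrix ::
  "('v, 'a) pre_digraph \<Rightarrow> ('v \<Rightarrow> nat) \<Rightarrow> (('v \<times> nat) \<times> ('v \<times> nat) \<times> 'a list \<Rightarrow> 'k) \<Rightarrow>
    ('v \<times> nat) \<times> ('v \<times> nat) \<times> 'a list \<Rightarrow> 'k" where
  "transpose_matrix Q d M = (\<lambda>(s, t, p)\<in>entries (op_quiver Q) d. M (t, s, rev p))"

context fin_digraph
begin

lemma summands_op_quiver: "summands (op_quiver G) d = summands G d"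
  by (simp add: summands_def op_quiver_def)

lemma entries_op_quiver: "(s, t, p) \<in> entries (op_quiver G) d \<longleftrightarrow> (t, s, rev p) \<in> entries G d"
  by (auto simp: entries_def summands_op_quiver mem_paths_op_quiver)

lemma bij_betw_transpose_matrix:
  "bij_betw (transpose_matrix G d) (entries G d \<rightarrow>\<^sub>E C) (entries (op_quiver G) d \<rightarrow>\<^sub>E C)"
proof (rule bij_betw_byWitness[where f' = "\<lambda>M. \<lambda>(s, t, p)\<in>entries G d. M (t, s, rev p)"])
  show "\<forall>M\<in>entries G d \<rightarrow>\<^sub>E C. (\<lambda>(s, t, p)\<in>entries G d. transpose_matrix G d M (t, s, rev p)) = M"
    by (auto simp: transpose_matrix_def fun_eq_iff entries_op_quiver restrict_def PiE_iff extensional_def)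
  show "\<forall>M\<in>entries (op_quiver G) d \<rightarrow>\<^sub>E C.
      transpose_matrix G d (\<lambda>(s, t, p)\<in>entries G d. M (t, s, rev p)) = M"
    by (auto simp: transpose_matrix_def fun_eq_iff entries_op_quiver restrict_def PiE_iff extensional_def)
  show "transpose_matrix G d ` (entries G d \<rightarrow>\<^sub>E C) \<subseteq> entries (op_quiver G) d \<rightarrow>\<^sub>E C"
    by (auto simp: transpose_matrix_def entries_op_quiver PiE_iff)
  show "(\<lambda>M. \<lambda>(s, t, p)\<in>entries G d. M (t, s, rev p)) ` (entries (op_quiver G) d \<rightarrow>\<^sub>E C) \<subseteq> entries G d \<rightarrow>\<^sub>E C"
    by (auto simp: entries_op_quiver PiE_iff)
qed

text \<open>Reversing a concatenation exchanges its two pieces, while the summand at the cut stays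
  the same. This is where the order of a product turns around.\<close>

lemma bij_betw_factorizations_op_quiver:
  "bij_betw (\<lambda>(u, r, q). (u, rev q, rev r)) (factorizations (op_quiver G) d i p j)
    (factorizations G d j (rev p) i)"
proof -
  have rev_eq: "rev q @ rev r = p \<longleftrightarrow> r @ q = rev p" for q r p :: "'b list"
    by (metis rev_append rev_rev_ident)
  show ?thesis
    by (rule bij_betw_byWitness[where f' = "\<lambda>(u, r, q). (u, rev q, rev r)"])
      (auto simp: factorizations_def summands_op_quiver mem_paths_op_quiver rev_eq)
qed

end

section \<open>The anti-isomorphism between the two endomorphism algebras\<close>

context quiver_projectives
begin

lemma quiver_projectives_op: "quiver_projectives K (op_quiver Q)"
proof -
  interpret op: fin_digraph "op_quiver Q" by (rule fin_digraph_op_quiver[OF Q.fin_digraph_axioms])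
  have "paths (op_quiver Q) i j \<subseteq> rev ` paths Q j i" for i j
    by (auto simp: Q.mem_paths_op_quiver image_iff intro!: bexI[of _ "rev _"])
  then have "finite (paths (op_quiver Q) i j)" for i j
    by (rule finite_subset) (simp add: finite_paths)
  then show ?thesis by unfold_locales
qed

lemma ex_anti_iso_End_algebra_op:
  "\<exists>h. h \<in> anti_iso A (End_algebra K (op_quiver Q) (proj_rep_sum K (op_quiver Q) d))"
proof -
  interpret op: quiver_projectives K "op_quiver Q" d by (rule quiver_projectives_op)
  let ?m = "path_matrix K Q d" and ?mo = "path_matrix K (op_quiver Q) d"
  \<comment> \<open>The map is transposition conjugated by the two matrix descriptions.
    \<open>mo_h\<close> and \<open>eqI\<close> then reduce each equation between endomorphisms to
    one between matrix entries.\<close>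
  define h where "h = inv_into (carrier op.A) ?mo \<circ> (transpose_matrix Q d \<circ> ?m)"
  have h_bij: "bij_betw h (carrier A) (carrier op.A)"
    unfolding h_def
    by (rule bij_betw_trans[OF bij_betw_trans[OF bij_betw_path_matrix Q.bij_betw_transpose_matrix]
          bij_betw_inv_into[OF op.bij_betw_path_matrix]])
  have h: "h f \<in> carrier op.A" if "f \<in> carrier A" for f
    using h_bij that by (rule bij_betw_apply)
  have mo_h: "?mo (h f) (s, t, p) = ?m f (t, s, rev p)"
    if "f \<in> carrier A" "(s, t, p) \<in> entries (op_quiver Q) d" for f s t p
  proof -
    have "transpose_matrix Q d (?m f) \<in> entries (op_quiver Q) d \<rightarrow>\<^sub>E carrier K"
      using that(1) by (intro bij_betw_apply[OF Q.bij_betw_transpose_matrix] path_matrix_mem)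
    then have "?mo (h f) = transpose_matrix Q d (?m f)"
      unfolding h_def o_apply by (rule bij_betw_inv_into_right[OF op.bij_betw_path_matrix])
    then show ?thesis using that(2) by (simp add: transpose_matrix_def)
  qed
  have eqI: "F = G" if F: "F \<in> carrier op.A" and G: "G \<in> carrier op.A"
    and eq: "\<And>s t p. (s, t, p) \<in> entries (op_quiver Q) d \<Longrightarrow> ?mo F (s, t, p) = ?mo G (s, t, p)" for F G
  proof -
    have "?mo F = ?mo G"
      by (rule PiE_ext[OF op.path_matrix_mem[OF F] op.path_matrix_mem[OF G]]) (auto intro: eq)
    then show ?thesis
      using op.bij_betw_path_matrix F G by (auto simp: bij_betw_def dest: inj_onD)
  qed
  interpret A: ring A by (rule ring_A)
  interpret Aop: ring op.A by (rule op.ring_A)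
  have "h (f \<oplus>\<^bsub>A\<^esub> g) = h f \<oplus>\<^bsub>op.A\<^esub> h g" if f: "f \<in> carrier A" and g: "g \<in> carrier A" for f g
  proof (rule eqI)
    fix s t p assume e: "(s, t, p) \<in> entries (op_quiver Q) d"
    then have e': "(t, s, rev p) \<in> entries Q d" by (simp add: Q.entries_op_quiver)
    show "?mo (h (f \<oplus>\<^bsub>A\<^esub> g)) (s, t, p) = ?mo (h f \<oplus>\<^bsub>op.A\<^esub> h g) (s, t, p)"
      by (simp only: op.path_matrix_add[OF e h[OF f] h[OF g]] mo_h[OF _ e] f g A.a_closed
          path_matrix_add[OF e' f g])
  qed (use f g h in auto)
  moreover have "h (f \<otimes>\<^bsub>A\<^esub> g) = h g \<otimes>\<^bsub>op.A\<^esub> h f" if f: "f \<in> carrier A" and g: "g \<in> carrier A" for f g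
  proof (rule eqI)
    fix s t p assume e: "(s, t, p) \<in> entries (op_quiver Q) d"
    then have e': "(t, s, rev p) \<in> entries Q d" by (simp add: Q.entries_op_quiver)
    from e' have st: "s \<in> S" "t \<in> S" by (auto simp: entries_def)
    let ?F = "factorizations (op_quiver Q) d (fst t) p (fst s)"
    let ?F' = "factorizations Q d (fst s) (rev p) (fst t)"
    let ?k = "\<lambda>(u, r, q). (u, rev q, rev r)"
    let ?T = "\<lambda>(u, r, q). ?m g (t, u, q) \<otimes> ?m f (u, s, r)"
    have k: "bij_betw ?k ?F ?F'" by (rule Q.bij_betw_factorizations_op_quiver)
    have T: "?T \<in> ?F' \<rightarrow> carrier K"
    proof (rule Pi_I)
      fix z assume "z \<in> ?F'"
      then obtain u r q where "z = (u, r, q)" "(t, u, q) \<in> entries Q d" "(u, s, r) \<in> entries Q d"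
        using st by (auto simp: factorizations_def entries_def)
      then show "?T z \<in> carrier K"
        using PiE_mem[OF path_matrix_mem[OF f], of "(u, s, r)"]
          PiE_mem[OF path_matrix_mem[OF g], of "(t, u, q)"] by simp
    qed
    have "?mo (h g \<otimes>\<^bsub>op.A\<^esub> h f) (s, t, p) =
        finsum K (\<lambda>(u, r, q). ?mo (h f) (s, u, q) \<otimes> ?mo (h g) (u, t, r)) ?F"
      by (rule op.path_matrix_mult[OF e h[OF g] h[OF f]])
    also have "\<dots> = finsum K (\<lambda>z. ?T (?k z)) ?F"
    proof (rule finsum_cong'[OF refl])
      show "(\<lambda>z. ?T (?k z)) \<in> ?F \<rightarrow> carrier K"
        by (rule Pi_I) (rule funcset_mem[OF T bij_betw_apply[OF k]])
      fix z assume z: "z \<in> ?F"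
      obtain u r q where z_eq: "z = (u, r, q)" by (cases z)
      with z st have "(s, u, q) \<in> entries (op_quiver Q) d" "(u, t, r) \<in> entries (op_quiver Q) d"
        by (simp_all add: factorizations_def entries_def Q.summands_op_quiver)
      moreover from this have "?m f (u, s, rev q) \<in> carrier K" "?m g (t, u, rev r) \<in> carrier K"
        using PiE_mem[OF path_matrix_mem[OF f], of "(u, s, rev q)"]
          PiE_mem[OF path_matrix_mem[OF g], of "(t, u, rev r)"]
        by (simp_all add: Q.entries_op_quiver)
      \<comment> \<open>After reindexing, the scalar factors stand in the opposite order to those of
        \<open>path_matrix_mult\<close>; commutativity of the field exchanges them.\<close>
      ultimately show "(case z of (u, r, q) \<Rightarrow> ?mo (h f) (s, u, q) \<otimes> ?mo (h g) (u, t, r)) = ?T (?k z)"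
        by (simp add: z_eq mo_h f g m_comm)
    qed
    also have "\<dots> = finsum K ?T (?k ` ?F)"
      using k T by (intro finsum_reindex[symmetric]) (simp_all add: bij_betw_def)
    also have "\<dots> = ?m (f \<otimes>\<^bsub>A\<^esub> g) (t, s, rev p)"
      unfolding bij_betw_imp_surj_on[OF k] by (rule path_matrix_mult[OF e' f g, symmetric])
    also have "\<dots> = ?mo (h (f \<otimes>\<^bsub>A\<^esub> g)) (s, t, p)"
      using f g by (intro mo_h[OF _ e, symmetric] A.m_closed)
    finally show "?mo (h (f \<otimes>\<^bsub>A\<^esub> g)) (s, t, p) = ?mo (h g \<otimes>\<^bsub>op.A\<^esub> h f) (s, t, p)" by simp
  qed (use f g h in auto)
  ultimately show ?thesis using h_bij by (intro exI[of _ h]) (simp add: anti_iso_def)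
qed

end

theorem corollary3p9:
  fixes K :: "('k, 'r) ring_scheme" and Q :: "('v, 'a) pre_digraph" and d :: "'v \<Rightarrow> nat"
  assumes "field K" and "finite (carrier K)"
    and "fin_digraph Q" and "acyclic_quiver Q"
  shows "commuting_pairs_count K Q d = commuting_pairs_count K (op_quiver Q) d"
proof -
  interpret Q: quiver_projectives K Q d
    by (rule quiver_projectives.intro[OF assms(1,3) quiver_projectives_axioms.intro])
      (rule fin_digraph.finite_paths_acyclic[OF assms(3,4)])
  interpret op: quiver_projectives K "op_quiver Q" d by (rule Q.quiver_projectives_op)
  obtain h where "h \<in> anti_iso Q.A op.A" using Q.ex_anti_iso_End_algebra_op by (rule exE)
  from anti_iso_card_commuting[OF Q.ring_A op.ring_A this] show ?thesis
    by (simp add: commuting_pairs_count_def Let_def)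
qed

end
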